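(* Let $\sigma=\sigma_0\cdots\sigma_i\cdots\sigma_{N+\rho-1}$ be a sequence of integers such that there are $N\ge 1$ singular sequences $\sigma_{i_j}=s_{k_j}$, $0\le j\le N-1$, and $0\le\rho\le N$ regular sequences $r_{m_l}$, $0\le l\le\rho-1$. Let $A\subset\mathbb Z/N\mathbb Z$ be defined by $$A=A(\sigma):=\{0\le j\le N-1 \mid \sigma_i \text{ is a regular sequence for } i=i_j+1 \bmod (N+\rho)\}.$$ Then $$\det M(\sigma)=P_A(k_0,\dots,k_{N-1})^2 .$$
   Context: Sequences. For $k\ge1$ the singular sequence $s_k$ is $(k+2,2,\dots,2)$ (length $k$); for $m\ge1$ the regular sequence $r_m$ is $(2,\dots,2)$ (length $m$). The sequence $\sigma$ is the concatenation of the singular and regular sequences $\sigma_0,\dots,\sigma_{N+\rho-1}$; the singular ones are numbered in order of occurrence ($i_0<\dots<i_{N-1}$), and whenever $\sigma_i$ is regular, $\sigma_{i-1}$ and $\sigma_{i+1}$ are singular (indices in $\mathbb Z/(N+\rho)\mathbb Z$). Write $\sigma=(a_0,\dots,a_{n-1})$, $n$ being its total length. Matrix. $M(\sigma)=(m_{ij})$ is the symmetric $n\times n$ matrix, with indices in $\mathbb Z/n\mathbb Z$, defined as follows: $m_{ii}=a_i$ if $a_i\ne n+1$ and $m_{ii}=n-1$ if $a_i=n+1$; for $0\le i<j\le n-1$, $m_{ij}=m_{ji}=-2$ if both congruences $j\equiv i+m_{ii}-1$ and $i\equiv j+m_{jj}-1$ mod $n$ hold, $m_{ij}=m_{ji}=-1$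 if exactly one of them holds, and $m_{ij}=m_{ji}=0$ in all other cases. Polynomials. Let $N\ge1$ and $A=\{a_1,\dots,a_p\}\subset\mathbb Z/N\mathbb Z$ with representatives $0\le a_1<\dots<a_p\le N-1$ (here the $a_i$ are elements of $A$, not the entries of $\sigma$). Define a partition of $\mathbb Z/N\mathbb Z$ into blocks by $A_1=\{k\mid 0\le k\le a_1 \text{ or } a_p<k\le N-1\}$ and $A_i=\{k\mid a_{i-1}<k\le a_i\}$ for $2\le i\le p$; if $A=\emptyset$ the only block is $A_1=\mathbb Z/N\mathbb Z$. A proper subset $B\subsetneq\mathbb Z/N\mathbb Z$ is a generating allowed subset relatively to $A$ if either $B=\{a\}$ with $a\in A$, or $B=\{k,k+1\}$ and $B$ is contained in one of the blocks $A_i$. A proper subset $B\subsetneq\mathbb Z/N\mathbb Z$ is allowed relatively to $A$ if it admits a (possibly empty) partition into generating allowed subsets; $\mathcal P_A$ is the set of allowed subsets. Then $$P_A(X_0,\dots,X_{N-1})=\sum_{B\in\mathcal P_A}\ \prod_{i\notin B}X_i .$$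
   Formalization: The congruences in M(σ) use a_i instead of m_ii; n≥2 is assumed, which excludes only σ=s_1; if A has a single element a_1, the pair {a_1,a_1+1} does not count as a generating allowed subset. The claim is false without each of these changes. *)

theory Defs
  imports
    "Jordan_Normal_Form.Determinant"
    "HOL-Number_Theory.Cong"
    "HOL-Library.Disjoint_Sets"
begin

definition singular_seq :: "nat \<Rightarrow> int list" where
  "singular_seq k = (int k + 2) # replicate (k - 1) 2"

definition regular_seq :: "nat \<Rightarrow> int list" where
  "regular_seq m = replicate m 2"

definition is_singular :: "int list \<Rightarrow> bool" where
  "is_singular s \<longleftrightarrow> (\<exists>k\<ge>1. s = singular_seq k)"

definition is_regular :: "int list \<Rightarrow> bool" where
  "is_regular s \<longleftrightarrow> (\<exists>m\<ge>1. s = regular_seq m)"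

definition diag_entry :: "int list \<Rightarrow> nat \<Rightarrow> int" where
  "diag_entry a i =
     (if a ! i = int (length a) + 1 then int (length a) - 1 else a ! i)"

text \<open>
  The congruences between indices use the term \<open>a\<^sub>i\<close> of the sequence, not the
  diagonal entry \<open>m\<^sub>i\<^sub>i\<close>. The two differ exactly when \<open>a\<^sub>i = n + 1\<close>. In that case
  \<open>i + a\<^sub>i - 1\<close> is congruent to \<open>i\<close> itself: this coincidence is what lowers the
  diagonal entry by \<open>2\<close>, and index \<open>i\<close> then points to no other index. Using
  \<open>m\<^sub>i\<^sub>i\<close> would make \<open>i\<close> point to \<open>i - 2\<close>, and e.g. the matrix of
  \<open>(4, 2, 2) = s\<^sub>2 r\<^sub>1\<close> would have determinant \<open>0\<close> instead of \<open>2\<^sup>2\<close>.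
  The length-one sequence \<open>(3) = s\<^sub>1\<close> shows the same coincidence, but there \<open>a\<^sub>0\<close>
  is \<open>n + 2\<close>, so that the rule for the diagonal does not apply: its matrix is \<open>(3)\<close>.
\<close>

definition points_to :: "int list \<Rightarrow> nat \<Rightarrow> nat \<Rightarrow> bool" where
  "points_to a i j \<longleftrightarrow> [int j = int i + a ! i - 1] (mod int (length a))"

definition seq_matrix :: "int list \<Rightarrow> int mat" where
  "seq_matrix a = mat (length a) (length a) (\<lambda>(i, j).
     if i = j then diag_entry a i
     else if points_to a i j \<and> points_to a j i then - 2
     else if points_to a i j \<or> points_to a j i then - 1
     else 0)"

text \<open>
  The integers modulo \<open>N\<close> are represented by \<open>{..<N}\<close>. With \<open>as = [a\<^sub>1, \<dots>, a\<^sub>p]\<close>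
  the sorted elements of \<open>A\<close>, \<open>as ! i\<close> is \<open>a\<^sub>i\<^sub>+\<^sub>1\<close>.
\<close>

definition blocks :: "nat \<Rightarrow> nat set \<Rightarrow> nat set set" where
  "blocks N A =
     (if A = {} then {{..<N}}
      else let as = sorted_list_of_set A; p = card A in
        insert {k. k < N \<and> (k \<le> as ! 0 \<or> as ! (p - 1) < k)}
          ((\<lambda>i. {k. as ! (i - 1) < k \<and> k \<le> as ! i}) ` {1..<p}))"

text \<open>
  A block is a cyclic interval that ends in an element of \<open>A\<close>, and a pair
  \<open>{k, k + 1}\<close> lies in it when its elements are consecutive there, so \<open>k\<close> must not
  be the end of the interval. The condition \<open>k \<notin> A\<close> follows from the inclusion
  in a block unless \<open>card A = 1\<close>. In that case, the only block is all of \<open>{..<N}\<close>,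
  regarded as the interval from \<open>a\<^sub>1 + 1\<close> around to \<open>a\<^sub>1\<close>, and the condition excludes
  the pair \<open>{a\<^sub>1, a\<^sub>1 + 1}\<close> formed by its two ends.
\<close>

definition generating_allowed :: "nat \<Rightarrow> nat set \<Rightarrow> nat set \<Rightarrow> bool" where
  "generating_allowed N A B \<longleftrightarrow> B \<subset> {..<N} \<and>
     ((\<exists>a\<in>A. B = {a}) \<or>
      (\<exists>k<N. k \<notin> A \<and> B = {k, (k + 1) mod N} \<and> (\<exists>C\<in>blocks N A. B \<subseteq> C)))"

definition allowed_subsets :: "nat \<Rightarrow> nat set \<Rightarrow> nat set set" where
  "allowed_subsets N A =
     {B. B \<subset> {..<N} \<and> (\<exists>\<B>. partition_on B \<B> \<and> (\<forall>G\<in>\<B>. generating_allowed N A G))}"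

definition P_poly :: "nat \<Rightarrow> nat set \<Rightarrow> (nat \<Rightarrow> 'a :: comm_semiring_1) \<Rightarrow> 'a" where
  "P_poly N A X = (\<Sum>B\<in>allowed_subsets N A. \<Prod>i\<in>{..<N} - B. X i)"

end

theory Submission
  imports Defs
begin

text \<open>
  Let \<open>e\<^sub>0, \<dots>, e\<^sub>n\<^sub>-\<^sub>1\<close> be the standard basis of the lattice of rank \<open>n\<close>, with indices read
  modulo \<open>n\<close>. The vectors
  \<open>D\<^sub>i = e\<^sub>i - e\<^sub>i\<^sub>+\<^sub>1 - \<dots> - e\<^sub>j\<close>, where \<open>j = i + a\<^sub>i - 1\<close>, have the entries of \<open>M(\<sigma>)\<close> as
  scalar products (\<open>row_product_distinct\<close>, \<open>row_product_diag\<close>). Hence \<open>M(\<sigma>)\<close> is the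
  product of the matrix \<open>C\<close> with rows \<open>D\<^sub>i\<close> and its transpose, its determinant is the square
  of \<open>det C\<close>, and it remains to show that \<open>det C = - P\<^sub>A(k\<^sub>0, \<dots>, k\<^sub>N\<^sub>-\<^sub>1)\<close>.

  If \<open>a\<^sub>i = 2\<close>, then \<open>D\<^sub>i = e\<^sub>i - e\<^sub>i\<^sub>+\<^sub>1\<close> identifies \<open>e\<^sub>i\<close> and \<open>e\<^sub>i\<^sub>+\<^sub>1\<close> modulo the rows of \<open>C\<close>. So only
  one basis vector \<open>g\<^sub>j\<close> survives for each singular entry, namely the common class of the
  positions that follow the previous singular entry, up to the \<open>j\<close>-th one itself. The row of
  the \<open>j\<close>-th singular entry becomes the relation
  \<open>g\<^sub>j = (k\<^sub>j + [j \<in> A]) g\<^sub>j\<^sub>+\<^sub>1 + [j \<notin> A] g\<^sub>j\<^sub>+\<^sub>2\<close>: the first \<open>k\<^sub>j\<close> subtracted vectors all have the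
  class \<open>g\<^sub>j\<^sub>+\<^sub>1\<close>, and the last one still has this class if a regular sequence follows, and the next
  class otherwise. Thus \<open>det C\<close> is the determinant of an \<open>N \<times> N\<close> cyclic second-order recurrence
  (\<open>det_row_mat\<close>).

  Such a recurrence has a nonzero solution when its monodromy \<open>Q\<close>, a product of \<open>2 \<times> 2\<close> transfer
  matrices, has the eigenvalue \<open>1\<close>; more precisely its determinant is
  \<open>det (1 - Q) = 1 - tr Q + det Q\<close> (\<open>det_cyclic_mat\<close>). An entry of \<open>Q\<close> is a sum over subsets \<open>B\<close> of
  \<open>{0, \<dots>, N - 1}\<close>: the transfer matrices describe a two-state automaton that reads the points
  \<open>0, \<dots>, N - 1\<close> and tiles \<open>B\<close> greedily by singletons from \<open>A\<close> and pairs \<open>{j, j + 1}\<close> with \<open>j \<notin> A\<close>, its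
  state telling whether the point to be read is the second one of a pair. Then \<open>tr Q\<close> collects
  the runs that close up around the circle. A proper subset \<open>B\<close> has exactly one such run if it is
  allowed and none otherwise. The full set, which \<open>P\<^sub>A\<close> leaves out, has one run if
  \<open>A \<noteq> \<emptyset>\<close> and \<open>1 + (-1)\<^sup>N\<close> runs if \<open>A = \<emptyset>\<close> (\<open>closed_runs_count\<close>). As \<open>det Q\<close> is the product of the
  numbers \<open>- [j \<notin> A]\<close>, this contribution cancels exactly against \<open>1 + det Q\<close>, and
  \<open>1 - tr Q + det Q = - P\<^sub>A\<close>.
\<close>

section \<open>Determinants of matrices with many unit rows\<close>

lemma det_simultaneous_permutation:
  fixes A :: "'a :: comm_ring_1 mat"
  assumes A: "A \<in> carrier_mat n n" and p: "p permutes {0..<n}"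
  shows "det (mat n n (\<lambda>(i, j). A $$ (p i, p j))) = det A"
proof -
  define B where "B = mat n n (\<lambda>(i, j). A $$ (p i, j))"
  have pn: "p i < n" if "i < n" for i
    using permutes_in_image[OF p, of i] that by simp
  have B: "B\<^sup>T \<in> carrier_mat n n"
    by (simp add: B_def)
  have "mat n n (\<lambda>(i, j). A $$ (p i, p j)) = (mat n n (\<lambda>(i, j). B\<^sup>T $$ (p i, j)))\<^sup>T"
    by (rule eq_matI) (auto simp: B_def pn)
  hence "det (mat n n (\<lambda>(i, j). A $$ (p i, p j))) = signof p * det (B\<^sup>T)"
    using det_permute_rows[OF B p] det_transpose[of "mat n n (\<lambda>(i, j). B\<^sup>T $$ (p i, j))" n]
    by simp
  also have "det (B\<^sup>T) = signof p * det A"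
    using det_permute_rows[OF A p] det_transpose[of B n] by (simp add: B_def)
  finally show ?thesis
    by (simp add: sign_def)
qed

text \<open>
  Expanding along a unit row removes that row and the column with the same index, so only the
  principal minor on the remaining indices is left. The indices are enumerated by an increasing
  function so that the minor is again a matrix over an initial segment.
\<close>

lemma det_unit_rows:
  fixes A :: "'a :: comm_ring_1 mat"
  assumes "A \<in> carrier_mat n n" and "strict_mono_on {..<N} q" and "q ` {..<N} \<subseteq> {..<n}"
    and "\<And>i c. i < n \<Longrightarrow> i \<notin> q ` {..<N} \<Longrightarrow> c < n \<Longrightarrow> A $$ (i, c) = of_bool (i = c)"
  shows "det A = det (mat N N (\<lambda>(r, c). A $$ (q r, q c)))"
  using assms
proof (induction n arbitrary: A q)
  case 0
  hence "N = 0" by auto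
  with 0 show ?case by simp
next
  case (Suc n)
  note A = Suc.prems(1) and mono = Suc.prems(2) and sub = Suc.prems(3) and unit = Suc.prems(4)
  have inj: "inj_on q {..<N}"
    using mono by (rule strict_mono_on_imp_inj_on)
  show ?case
  proof (cases "q ` {..<N} = {..<Suc n}")
    case True
    hence "card (q ` {..<N}) = Suc n"
      by simp
    hence N: "N = Suc n"
      using card_image[OF inj] by simp
    have "q r = r" if "r < N" for r
    proof -
      have ge: "r \<le> q r" if "r < N" for r
        using that
      proof (induction r)
        case (Suc r)
        moreover have "q r < q (Suc r)"
          using mono Suc.prems by (auto simp: strict_mono_on_def)
        ultimately show ?case
          by simp
      qed simp
      have le: "q (N - Suc d) \<le> N - Suc d" if "d < N" for d
        using that
      proof (induction d)
        case 0
        thus ?case using sub N by force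
      next
        case (Suc d)
        moreover have "q (N - Suc (Suc d)) < q (N - Suc d)"
          using mono Suc.prems by (auto simp: strict_mono_on_def)
        ultimately show ?case
          by simp
      qed
      show ?thesis
        using ge[OF that] le[of "N - Suc r"] that by simp
    qed
    hence "mat N N (\<lambda>(r, c). A $$ (q r, q c)) = A"
      using A N by (intro eq_matI) auto
    thus ?thesis by simp
  next
    case False
    then obtain i where i: "i < Suc n" "i \<notin> q ` {..<N}"
      using sub by blast
    \<comment> \<open>Deleting index \<open>i\<close> renumbers the others: \<open>s\<close> maps new indices to old ones, and \<open>q'\<close> is \<open>q\<close> in
      the new numbering.\<close>
    define s where "s j = (if j < i then j else Suc j)" for j
    define q' where "q' r = (if q r < i then q r else q r - 1)" for r
    have ne: "q r \<noteq> i" if "r < N" for r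
      using i that by auto
    have sq': "s (q' r) = q r" if "r < N" for r
      using ne[OF that] by (auto simp: s_def q'_def)
    have del: "mat_delete A i i = mat n n (\<lambda>(a, c). A $$ (s a, s c))"
      using A by (simp add: mat_delete_def s_def)
    have "det A = (\<Sum>j<Suc n. A $$ (i, j) * cofactor A i j)"
      by (rule laplace_expansion_row[OF A i(1)])
    also have "\<dots> = (\<Sum>j<Suc n. if j = i then cofactor A i i else 0)"
      using unit[OF i] by (intro sum.cong) auto
    also have "\<dots> = det (mat_delete A i i)"
      using i by (simp add: cofactor_def)
    also have "\<dots> = det (mat N N (\<lambda>(r, c). mat_delete A i i $$ (q' r, q' c)))"
    proof (rule Suc.IH)
      show "mat_delete A i i \<in> carrier_mat n n"
        by (simp add: del)
      show "strict_mono_on {..<N} q'"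
      proof (rule strict_mono_onI)
        fix r t assume "r \<in> {..<N}" "t \<in> {..<N}" "r < t"
        moreover from this have "q r < q t"
          using mono by (auto simp: strict_mono_on_def)
        ultimately show "q' r < q' t"
          using ne[of r] ne[of t] by (auto simp: q'_def)
      qed
      show "q' ` {..<N} \<subseteq> {..<n}"
      proof
        fix x assume "x \<in> q' ` {..<N}"
        then obtain r where r: "r < N" "x = q' r" by auto
        moreover have "q r < Suc n" using sub r by auto
        ultimately show "x \<in> {..<n}"
          using ne[of r] i by (auto simp: q'_def)
      qed
      fix a c assume a: "a < n" "a \<notin> q' ` {..<N}" and c: "c < n"
      have "s a \<notin> q ` {..<N}"
      proof
        assume "s a \<in> q ` {..<N}"
        then obtain r where r: "r < N" "s a = s (q' r)"
          using sq' by auto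
        hence "a = q' r"
          by (auto simp: s_def split: if_splits)
        thus False using a r by auto
      qed
      moreover have "s a < Suc n" "s c < Suc n" "s a = s c \<longleftrightarrow> a = c"
        using a c by (auto simp: s_def)
      ultimately show "mat_delete A i i $$ (a, c) = of_bool (a = c)"
        using unit[of "s a" "s c"] a c by (simp add: del)
    qed
    also have "mat N N (\<lambda>(r, c). mat_delete A i i $$ (q' r, q' c)) = mat N N (\<lambda>(r, c). A $$ (q r, q c))"
    proof -
      have "q' r < n" if "r < N" for r
        using ne[OF that] i sub that by (force simp: q'_def)
      thus ?thesis
        by (intro eq_matI) (auto simp: del sq')
    qed
    finally show ?thesis .
  qed
qed

text \<open>
  Partial sums of the columns arise by multiplication with the unitriangular matrix of ones.
\<close>

lemma det_column_sums:
  fixes f :: "nat \<Rightarrow> nat \<Rightarrow> 'a :: idom"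
  shows "det (mat n n (\<lambda>(i, l). \<Sum>x\<le>l. f i x)) = det (mat n n (\<lambda>(i, x). f i x))"
proof -
  define U :: "'a mat" where "U = mat n n (\<lambda>(x, l). of_bool (x \<le> l))"
  have "mat n n (\<lambda>(i, l). \<Sum>x\<le>l. f i x) = mat n n (\<lambda>(i, x). f i x) * U" (is "?L = ?F * U")
  proof (rule eq_matI)
    fix i l assume *: "i < dim_row (?F * U)" "l < dim_col (?F * U)"
    hence il: "i < n" "l < n" by (auto simp: U_def)
    have "(?F * U) $$ (i, l) = (\<Sum>x\<in>{0..<n}. f i x * of_bool (x \<le> l))"
      using il by (simp add: U_def scalar_prod_def)
    also have "\<dots> = (\<Sum>x\<le>l. f i x)"
      using il by (intro sum.mono_neutral_cong_right) auto
    finally show "?L $$ (i, l) = (?F * U) $$ (i, l)"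
      using il by simp
  qed (auto simp: U_def)
  moreover have "det U = 1"
  proof -
    have "det U = prod_list (diag_mat U)"
      by (rule det_upper_triangular[of _ n]) (auto simp: U_def upper_triangular_def)
    also have "diag_mat U = replicate n 1"
      by (auto simp: diag_mat_def U_def list_eq_iff_nth_eq)
    finally show ?thesis by simp
  qed
  ultimately show ?thesis
    by (simp add: det_mult[of _ n] U_def)
qed

section \<open>Cyclic second-order recurrences\<close>

text \<open>
  The recurrence \<open>g\<^sub>j = \<alpha>\<^sub>j g\<^sub>j\<^sub>+\<^sub>1 + \<beta>\<^sub>j g\<^sub>j\<^sub>+\<^sub>2\<close> turns \<open>x g\<^sub>j + y g\<^sub>j\<^sub>+\<^sub>1\<close> into a linear form in
  \<open>g\<^sub>j\<^sub>+\<^sub>1, g\<^sub>j\<^sub>+\<^sub>2\<close>. In matrix terms, the row vector \<open>v\<close> is multiplied from the right by the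
  matrices with rows \<open>(\<alpha>\<^sub>j, \<beta>\<^sub>j)\<close> and \<open>(1, 0)\<close>, for \<open>j < m\<close>.
\<close>

primrec transfer :: "(nat \<Rightarrow> 'a :: comm_ring_1) \<Rightarrow> (nat \<Rightarrow> 'a) \<Rightarrow> 'a \<times> 'a \<Rightarrow> nat \<Rightarrow> 'a \<times> 'a" where
  "transfer \<alpha> \<beta> v 0 = v"
| "transfer \<alpha> \<beta> v (Suc m) =
     (let (x, y) = transfer \<alpha> \<beta> v m in (x * \<alpha> m + y, x * \<beta> m))"

text \<open>
  The system \<open>g\<^sub>j - \<alpha>\<^sub>j g\<^sub>j\<^sub>+\<^sub>1 - \<beta>\<^sub>j g\<^sub>j\<^sub>+\<^sub>2 = 0\<close> with indices modulo \<open>N\<close>. The three indicators are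
  superposed so that the coefficients accumulate when the columns coincide, for \<open>N \<le> 2\<close>.
\<close>

definition cyclic_mat :: "nat \<Rightarrow> (nat \<Rightarrow> 'a) \<Rightarrow> (nat \<Rightarrow> 'a) \<Rightarrow> 'a :: comm_ring_1 mat" where
  "cyclic_mat N \<alpha> \<beta> = mat N N (\<lambda>(j, c).
     of_bool (c = j) - \<alpha> j * of_bool (c = Suc j mod N) - \<beta> j * of_bool (c = Suc (Suc j) mod N))"

text \<open>
  Subtracting \<open>x\<close> times a relation from a linear form with first coefficient \<open>x\<close> performs one
  transfer step, so these multiples of the first \<open>m\<close> relations add up to the difference between
  the initial form and the transferred one.
\<close>

lemma transfer_telescope:
  "(\<Sum>j<m. fst (transfer \<alpha> \<beta> v j) *
      (of_bool (c = j) - \<alpha> j * of_bool (c = Suc j) - \<beta> j * of_bool (c = Suc (Suc j)))) =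
   fst v * of_bool (c = 0) + snd v * of_bool (c = 1) -
   fst (transfer \<alpha> \<beta> v m) * of_bool (c = m) - snd (transfer \<alpha> \<beta> v m) * of_bool (c = Suc m)"
  by (induction m) (auto simp: case_prod_beta Let_def algebra_simps)

lemma det_mat_2:
  fixes f :: "nat \<times> nat \<Rightarrow> 'a :: comm_ring_1"
  shows "det (mat 2 2 f) = f (0, 0) * f (1, 1) - f (0, 1) * f (1, 0)"
proof -
  have "det (mat 2 2 f) = (\<Sum>j<2. mat 2 2 f $$ (0, j) * cofactor (mat 2 2 f) 0 j)"
    by (rule laplace_expansion_row[of _ 2]) auto
  also have "\<dots> = f (0, 0) * f (1, 1) - f (0, 1) * f (1, 0)"
    by (simp add: numeral_2_eq_2 cofactor_def det_single mat_delete_def)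
  finally show ?thesis .
qed

text \<open>
  With \<open>Q\<close> the product of all transfer matrices, whose rows are \<open>(a, b)\<close> and \<open>(c, d)\<close>, the right
  side is \<open>det (1 - Q)\<close>. The first \<open>N - 2\<close> relations do not wrap around and have leading
  coefficient \<open>1\<close>. They are used to eliminate \<open>g\<^sub>0, \<dots>, g\<^sub>N\<^sub>-\<^sub>3\<close> from the last two relations, which
  leaves a \<open>2 \<times> 2\<close> determinant.
\<close>

lemma det_cyclic_mat:
  fixes \<alpha> \<beta> :: "nat \<Rightarrow> 'a :: idom"
  assumes "N \<ge> 1"
    and "transfer \<alpha> \<beta> (1, 0) N = (a, b)" and "transfer \<alpha> \<beta> (0, 1) N = (c, d)"
  shows "det (cyclic_mat N \<alpha> \<beta>) = 1 - (a + d) + (a * d - b * c)"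
proof (cases "N = 1")
  case True
  have "det (cyclic_mat N \<alpha> \<beta>) = cyclic_mat N \<alpha> \<beta> $$ (0, 0)"
    using True by (intro det_single) (auto simp: cyclic_mat_def)
  thus ?thesis
    using assms True by (auto simp: cyclic_mat_def)
next
  case False
  then obtain m where N: "N = m + 2"
    using assms(1) by (metis One_nat_def Suc_1 add.commute le_Suc_ex le_antisym not_less_eq_eq)
  define T where "T = cyclic_mat N \<alpha> \<beta>"
  define u where "u = transfer \<alpha> \<beta> (1, 0) m"
  define w where "w = transfer \<alpha> \<beta> (0, 1) m"
  define p where "p j = fst (transfer \<alpha> \<beta> (1, 0) j)" for j
  define r where "r j = fst (transfer \<alpha> \<beta> (0, 1) j)" for j
  \<comment> \<open>The wrap-around terms of the last two relations are \<open>- \<beta>\<^sub>m g\<^sub>0\<close> and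
    \<open>- \<alpha>\<^sub>m\<^sub>+\<^sub>1 g\<^sub>0 - \<beta>\<^sub>m\<^sub>+\<^sub>1 g\<^sub>1\<close>; \<open>V\<close> transfers them to \<open>g\<^sub>m\<close> and \<open>g\<^sub>m\<^sub>+\<^sub>1\<close>, which gives \<open>D\<close>.\<close>
  define V where "V = mat N N (\<lambda>(i, j). if i = j then 1
      else if j < m then
        (if i = m then \<beta> m * p j
         else if i = Suc m then \<alpha> (Suc m) * p j + \<beta> (Suc m) * r j else 0)
      else 0)"
  define D where "D = mat 2 2 (\<lambda>(i, c).
      if i = 0 then of_bool (c = 0) - \<alpha> m * of_bool (c = 1) - \<beta> m * (if c = 0 then fst u else snd u)
      else of_bool (c = 1) - \<alpha> (Suc m) * (if c = 0 then fst u else snd u)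
             - \<beta> (Suc m) * (if c = 0 then fst w else snd w))"
  have T: "T \<in> carrier_mat N N" and V: "V \<in> carrier_mat N N"
    by (simp_all add: T_def cyclic_mat_def V_def)
  have Tj: "T $$ (j, c) = of_bool (c = j) - \<alpha> j * of_bool (c = Suc j) - \<beta> j * of_bool (c = Suc (Suc j))"
    if "j < m" "c < N" for j c
    using that by (simp add: T_def cyclic_mat_def N)
  have VT: "(V * T) $$ (i, c) = (\<Sum>j<m. V $$ (i, j) * T $$ (j, c)) +
      V $$ (i, m) * T $$ (m, c) + V $$ (i, Suc m) * T $$ (Suc m, c)" if "i < N" "c < N" for i c
    using that T V by (simp add: scalar_prod_def N atLeast0LessThan)
  have sp: "(\<Sum>j<m. p j * T $$ (j, c)) =
      of_bool (c = 0) - fst u * of_bool (c = m) - snd u * of_bool (c = Suc m)" if "c < N" for c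
    using transfer_telescope[where v = "(1, 0)" and m = m and c = c and \<alpha> = \<alpha> and \<beta> = \<beta>] that
    by (simp add: p_def u_def Tj)
  have sr: "(\<Sum>j<m. r j * T $$ (j, c)) =
      of_bool (c = 1) - fst w * of_bool (c = m) - snd w * of_bool (c = Suc m)" if "c < N" for c
    using transfer_telescope[where v = "(0, 1)" and m = m and c = c and \<alpha> = \<alpha> and \<beta> = \<beta>] that
    by (simp add: r_def w_def Tj)
  have VT_top: "(V * T) $$ (i, c) = T $$ (i, c)" if "i < m" "c < N" for i c
  proof -
    have "(\<Sum>j<m. V $$ (i, j) * T $$ (j, c)) = (\<Sum>j<m. if j = i then T $$ (i, c) else 0)"
      using that by (intro sum.cong) (auto simp: V_def N)
    thus ?thesis
      using that VT[of i c] by (simp add: V_def N)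
  qed
  have VT_m: "(V * T) $$ (m, c) = of_bool (c = m) - \<alpha> m * of_bool (c = Suc m)
      - \<beta> m * (fst u * of_bool (c = m) + snd u * of_bool (c = Suc m))" if "c < N" for c
  proof -
    have "(\<Sum>j<m. V $$ (m, j) * T $$ (j, c)) = \<beta> m * (\<Sum>j<m. p j * T $$ (j, c))"
      unfolding sum_distrib_left by (intro sum.cong) (auto simp: V_def N mult_ac)
    moreover have "T $$ (m, c) = of_bool (c = m) - \<alpha> m * of_bool (c = Suc m) - \<beta> m * of_bool (c = 0)"
      using that by (simp add: T_def cyclic_mat_def N)
    ultimately show ?thesis
      using that VT[of m c] sp[OF that] by (simp add: V_def N algebra_simps)
  qed
  have VT_Sm: "(V * T) $$ (Suc m, c) = of_bool (c = Suc m)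
      - \<alpha> (Suc m) * (fst u * of_bool (c = m) + snd u * of_bool (c = Suc m))
      - \<beta> (Suc m) * (fst w * of_bool (c = m) + snd w * of_bool (c = Suc m))" if "c < N" for c
  proof -
    have "(\<Sum>j<m. V $$ (Suc m, j) * T $$ (j, c)) =
        \<alpha> (Suc m) * (\<Sum>j<m. p j * T $$ (j, c)) + \<beta> (Suc m) * (\<Sum>j<m. r j * T $$ (j, c))"
      unfolding sum_distrib_left sum.distrib[symmetric]
      by (intro sum.cong) (auto simp: V_def N algebra_simps)
    moreover have "T $$ (Suc m, c) =
        of_bool (c = Suc m) - \<alpha> (Suc m) * of_bool (c = 0) - \<beta> (Suc m) * of_bool (c = 1)"
      using that by (simp add: T_def cyclic_mat_def N mod_Suc)
    ultimately show ?thesis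
      using that VT[of "Suc m" c] sp[OF that] sr[OF that] by (simp add: V_def N algebra_simps)
  qed
  define T1 where "T1 = mat m m (\<lambda>(i, c). T $$ (i, c))"
  define T2 where "T2 = mat m 2 (\<lambda>(i, c). T $$ (i, m + c))"
  have "V * T = four_block_mat T1 T2 (0\<^sub>m 2 m) D"
  proof (rule eq_matI)
    fix i c assume "i < dim_row (four_block_mat T1 T2 (0\<^sub>m 2 m) D)"
      and "c < dim_col (four_block_mat T1 T2 (0\<^sub>m 2 m) D)"
    hence ic: "i < N" "c < N"
      by (auto simp: T1_def D_def N)
    consider "i < m" | "i = m" | "i = Suc m"
      using ic N by linarith
    thus "(V * T) $$ (i, c) = four_block_mat T1 T2 (0\<^sub>m 2 m) D $$ (i, c)"
    proof cases
      case 1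
      thus ?thesis
        using ic by (simp add: VT_top T1_def T2_def D_def N)
    next
      case 2
      have "c < m \<or> c = m \<or> c = Suc m" using ic N by linarith
      thus ?thesis
        using ic 2 by (auto simp: VT_m T1_def T2_def D_def N)
    next
      case 3
      have "c < m \<or> c = m \<or> c = Suc m" using ic N by linarith
      thus ?thesis
        using ic 3 by (auto simp: VT_Sm T1_def T2_def D_def N)
    qed
  qed (use T V in \<open>auto simp: T1_def D_def N\<close>)
  hence "det (V * T) = det T1 * det D"
    by (simp add: det_four_block_mat_lower_left_zero[of _ m _ 2] T1_def T2_def D_def)
  moreover have "det T1 = 1"
  proof -
    have "det T1 = prod_list (diag_mat T1)"
      by (rule det_upper_triangular[of _ m]) (auto simp: T1_def Tj N upper_triangular_def)
    also have "diag_mat T1 = replicate m 1"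
      by (auto simp: diag_mat_def T1_def Tj N list_eq_iff_nth_eq)
    finally show ?thesis by simp
  qed
  moreover have "det V = 1"
  proof -
    have "det V = prod_list (diag_mat V)"
      by (rule det_lower_triangular[of N]) (auto simp: V_def N)
    also have "diag_mat V = replicate N 1"
      by (auto simp: diag_mat_def V_def list_eq_iff_nth_eq)
    finally show ?thesis by simp
  qed
  ultimately have "det T = det D"
    by (simp add: det_mult[OF V T])
  also have "\<dots> = 1 - (a + d) + (a * d - b * c)"
  proof -
    have "a = (fst u * \<alpha> m + snd u) * \<alpha> (Suc m) + fst u * \<beta> m"
      and "b = (fst u * \<alpha> m + snd u) * \<beta> (Suc m)"
      and "c = (fst w * \<alpha> m + snd w) * \<alpha> (Suc m) + fst w * \<beta> m"
      and "d = (fst w * \<alpha> m + snd w) * \<beta> (Suc m)"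
      using assms(2,3) by (auto simp: N u_def w_def case_prod_beta Let_def)
    thus ?thesis
      by (simp add: D_def det_mat_2 algebra_simps)
  qed
  finally show ?thesis
    by (simp add: T_def)
qed

section \<open>Transfer matrices as sums over subsets\<close>

text \<open>
  One step of the greedy tiling of \<open>B\<close>. The state is true when the point \<open>j\<close> is the second
  element of the pair that begins at the preceding point, so it must lie in \<open>B\<close>. Otherwise a
  point of \<open>B\<close> is a singleton if it lies in \<open>A\<close>, and begins a pair if it does not. No choice is
  left, and hence a tiling is determined by its initial state.
\<close>

fun tile_step :: "nat set \<Rightarrow> nat set \<Rightarrow> nat \<Rightarrow> bool \<Rightarrow> bool option" where
  "tile_step A B j True = (if j \<in> B then Some False else None)"
| "tile_step A B j False = Some (j \<in> B \<and> j \<notin> A)"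

primrec tile_run :: "nat set \<Rightarrow> nat set \<Rightarrow> bool \<Rightarrow> nat \<Rightarrow> bool option" where
  "tile_run A B s 0 = Some s"
| "tile_run A B s (Suc m) = Option.bind (tile_run A B s m) (tile_step A B m)"

lemma tile_run_eq_Some_iff:
  "tile_run A B s m = Some t \<longleftrightarrow>
     (\<exists>e. e 0 = s \<and> e m = t \<and> (\<forall>j<m. tile_step A B j (e j) = Some (e (Suc j))))"
proof (induction m arbitrary: t)
  case 0
  show ?case by auto
next
  case (Suc m)
  show ?case
  proof
    assume "tile_run A B s (Suc m) = Some t"
    then obtain u where u: "tile_run A B s m = Some u" "tile_step A B m u = Some t"
      by (auto simp: bind_eq_Some_conv)
    then obtain e where e: "e 0 = s" "e m = u" "\<forall>j<m. tile_step A B j (e j) = Some (e (Suc j))"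
      using Suc.IH by blast
    define e' where "e' = e(Suc m := t)"
    have "e' 0 = s \<and> e' (Suc m) = t \<and> (\<forall>j<Suc m. tile_step A B j (e' j) = Some (e' (Suc j)))"
      using e u by (auto simp: e'_def less_Suc_eq)
    thus "\<exists>e. e 0 = s \<and> e (Suc m) = t \<and> (\<forall>j<Suc m. tile_step A B j (e j) = Some (e (Suc j)))"
      by blast
  next
    assume "\<exists>e. e 0 = s \<and> e (Suc m) = t \<and> (\<forall>j<Suc m. tile_step A B j (e j) = Some (e (Suc j)))"
    then obtain e where e: "e 0 = s" "e (Suc m) = t"
        "\<forall>j<Suc m. tile_step A B j (e j) = Some (e (Suc j))"
      by blast
    hence "\<forall>j<m. tile_step A B j (e j) = Some (e (Suc j))"
      by simp
    hence "tile_run A B s m = Some (e m)"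
      using Suc.IH[of "e m"] e(1) by blast
    thus "tile_run A B s (Suc m) = Some t"
      using e by simp
  qed
qed

lemma tile_step_cong:
  "(j \<in> B \<longleftrightarrow> j \<in> B') \<Longrightarrow> tile_step A B j u = tile_step A B' j u"
  by (cases u) auto

lemma tile_run_cong:
  "(\<And>j. j < m \<Longrightarrow> j \<in> B \<longleftrightarrow> j \<in> B') \<Longrightarrow> tile_run A B s m = tile_run A B' s m"
proof (induction m)
  case (Suc m)
  have "tile_step A B m = tile_step A B' m"
    using Suc.prems[of m] by (intro ext tile_step_cong) simp
  with Suc show ?case by simp
qed simp

definition run_sum :: "nat set \<Rightarrow> (nat \<Rightarrow> 'a :: comm_ring_1) \<Rightarrow> bool \<Rightarrow> bool \<Rightarrow> nat \<Rightarrow> 'a" where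
  "run_sum A X s t m =
     (\<Sum>B\<in>Pow {..<m}. of_bool (tile_run A B s m = Some t) * (\<Prod>i\<in>{..<m} - B. X i))"

text \<open>
  A subset of \<open>{..<Suc m}\<close> either omits \<open>m\<close>, which contributes the factor \<open>X m\<close>, or contains it.
\<close>

lemma run_sum_Suc_split:
  "run_sum A X s t (Suc m) =
     (\<Sum>B\<in>Pow {..<m}. (\<Prod>i\<in>{..<m} - B. X i) *
       (of_bool (Option.bind (tile_run A B s m) (tile_step A {} m) = Some t) * X m +
        of_bool (Option.bind (tile_run A B s m) (tile_step A {m} m) = Some t)))"
proof -
  let ?w = "\<lambda>B. of_bool (tile_run A B s (Suc m) = Some t) * (\<Prod>i\<in>{..<Suc m} - B. X i)"
  have Pow: "Pow {..<Suc m} = Pow {..<m} \<union> insert m ` Pow {..<m}"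
    by (simp add: lessThan_Suc Pow_insert)
  have "run_sum A X s t (Suc m) = (\<Sum>B\<in>Pow {..<m}. ?w B) + (\<Sum>B\<in>insert m ` Pow {..<m}. ?w B)"
    unfolding run_sum_def Pow by (intro sum.union_disjoint) auto
  also have "(\<Sum>B\<in>insert m ` Pow {..<m}. ?w B) = (\<Sum>B\<in>Pow {..<m}. ?w (insert m B))"
    by (intro sum.reindex_cong[of "insert m"]) (auto simp: inj_on_def)
  also have "(\<Sum>B\<in>Pow {..<m}. ?w B) + (\<Sum>B\<in>Pow {..<m}. ?w (insert m B)) =
     (\<Sum>B\<in>Pow {..<m}. (\<Prod>i\<in>{..<m} - B. X i) *
       (of_bool (Option.bind (tile_run A B s m) (tile_step A {} m) = Some t) * X m +
        of_bool (Option.bind (tile_run A B s m) (tile_step A {m} m) = Some t)))"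
    unfolding sum.distrib[symmetric]
  proof (intro sum.cong refl)
    fix B assume B: "B \<in> Pow {..<m}"
    have "tile_run A (insert m B) s m = tile_run A B s m"
      by (intro tile_run_cong) auto
    moreover have "tile_step A (insert m B) m = tile_step A {m} m"
      by (intro ext tile_step_cong) auto
    moreover have "tile_step A B m = tile_step A {} m"
      using B by (intro ext tile_step_cong) auto
    moreover have "{..<Suc m} - insert m B = {..<m} - B"
      by auto
    moreover have "{..<Suc m} - B = insert m ({..<m} - B)"
      using B by auto
    ultimately show "?w B + ?w (insert m B) = (\<Prod>i\<in>{..<m} - B. X i) *
       (of_bool (Option.bind (tile_run A B s m) (tile_step A {} m) = Some t) * X m +
        of_bool (Option.bind (tile_run A B s m) (tile_step A {m} m) = Some t))"
      by (simp add: algebra_simps)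
  qed
  finally show ?thesis .
qed

lemma run_sum_False_Suc:
  "run_sum A X s False (Suc m) =
     run_sum A X s False m * (X m + of_bool (m \<in> A)) + run_sum A X s True m"
  unfolding run_sum_Suc_split unfolding run_sum_def sum_distrib_right sum.distrib[symmetric]
proof (intro sum.cong refl)
  fix B
  show "(\<Prod>i\<in>{..<m} - B. X i) *
       (of_bool (Option.bind (tile_run A B s m) (tile_step A {} m) = Some False) * X m +
        of_bool (Option.bind (tile_run A B s m) (tile_step A {m} m) = Some False)) =
     of_bool (tile_run A B s m = Some False) * (\<Prod>i\<in>{..<m} - B. X i) * (X m + of_bool (m \<in> A)) +
     of_bool (tile_run A B s m = Some True) * (\<Prod>i\<in>{..<m} - B. X i)"
  proof (cases "tile_run A B s m")
    case (Some u)
    thus ?thesis by (cases u) (auto simp: algebra_simps)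
  qed simp
qed

lemma run_sum_True_Suc:
  "run_sum A X s True (Suc m) = run_sum A X s False m * of_bool (m \<notin> A)"
  unfolding run_sum_Suc_split unfolding run_sum_def sum_distrib_right
proof (intro sum.cong refl)
  fix B
  show "(\<Prod>i\<in>{..<m} - B. X i) *
       (of_bool (Option.bind (tile_run A B s m) (tile_step A {} m) = Some True) * X m +
        of_bool (Option.bind (tile_run A B s m) (tile_step A {m} m) = Some True)) =
     of_bool (tile_run A B s m = Some False) * (\<Prod>i\<in>{..<m} - B. X i) * of_bool (m \<notin> A)"
  proof (cases "tile_run A B s m")
    case (Some u)
    thus ?thesis by (cases u) auto
  qed simp
qed

text \<open>
  The two recursion equations above say that \<open>run_sum\<close>, as a \<open>2 \<times> 2\<close> matrix indexed by the initial
  and the final state, is the product of the matrices with rows \<open>(X\<^sub>j + [j \<in> A], [j \<notin> A])\<close> and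
  \<open>(1, 0)\<close>.
\<close>

lemma transfer_eq_run_sum:
  "transfer (\<lambda>j. X j + of_bool (j \<in> A)) (\<lambda>j. of_bool (j \<notin> A)) (of_bool (\<not> s), of_bool s) m =
     (run_sum A X s False m, run_sum A X s True m)"
proof (induction m)
  case 0
  show ?case by (simp add: run_sum_def)
next
  case (Suc m)
  thus ?case by (simp add: run_sum_False_Suc run_sum_True_Suc)
qed

lemma run_sum_det:
  "run_sum A X False False m * run_sum A X True True m -
   run_sum A X False True m * run_sum A X True False m = (\<Prod>j<m. - of_bool (j \<notin> A))"
proof (induction m)
  case 0
  show ?case by (simp add: run_sum_def)
next
  case (Suc m)
  show ?case
    unfolding prod.lessThan_Suc Suc.IH[symmetric]
    by (simp add: run_sum_False_Suc run_sum_True_Suc algebra_simps)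
qed

section \<open>Allowed subsets as closed runs\<close>

text \<open>
  A block is either everything or a cyclic interval ending in an element of \<open>A\<close>, so a point outside
  \<open>A\<close> is never the last one of its block.
\<close>

lemma pair_in_block:
  assumes "A \<subseteq> {..<N}" and k: "k < N" "k \<notin> A"
  shows "\<exists>C\<in>blocks N A. {k, Suc k mod N} \<subseteq> C"
proof (cases "A = {}")
  case True
  thus ?thesis using k by (auto simp: blocks_def)
next
  case False
  define as where "as = sorted_list_of_set A"
  define p where "p = card A"
  have fin: "finite A"
    using assms(1) finite_subset by blast
  have p: "p > 0" "length as = p"
    using False fin by (simp_all add: p_def as_def card_gt_0_iff)
  have set: "set as = A"
    using fin by (simp add: as_def)
  have mono: "as ! i \<le> as ! j" if "i \<le> j" "j < p" for i j
    using that p by (simp add: as_def sorted_nth_mono)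
  have mem: "as ! i \<in> A" if "i < p" for i
    using that p set nth_mem by metis
  define C where "C = {x. x < N \<and> (x \<le> as ! 0 \<or> as ! (p - 1) < x)}"
  define D where "D i = {x. as ! (i - 1) < x \<and> x \<le> as ! i}" for i
  have blocks: "blocks N A = insert C (D ` {1..<p})"
    using False unfolding blocks_def Let_def C_def D_def as_def p_def by auto
  have nk: "as ! i \<noteq> k" if "i < p" for i
    using mem[OF that] k by auto
  consider "k < as ! 0" | "as ! (p - 1) < k" | "as ! 0 < k" "k < as ! (p - 1)"
    using nk[of 0] nk[of "p - 1"] p by linarith
  thus ?thesis
  proof cases
    case 1
    moreover have "as ! 0 < N"
      using mem[of 0] p assms(1) by auto
    ultimately have "{k, Suc k mod N} \<subseteq> C"
      by (auto simp: C_def)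
    thus ?thesis unfolding blocks by blast
  next
    case 2
    hence "{k, Suc k mod N} \<subseteq> C"
      using k by (auto simp: C_def mod_Suc)
    thus ?thesis unfolding blocks by blast
  next
    case 3
    define i where "i = (LEAST i. k < as ! i)"
    have i: "k < as ! i" "i \<le> p - 1"
      unfolding i_def using 3(2) by (auto intro: LeastI Least_le)
    have "i \<noteq> 0"
      using i(1) 3(1) by (intro notI) simp
    hence "\<not> k < as ! (i - 1)"
      using not_less_Least[of "i - 1" "\<lambda>i. k < as ! i"] by (simp add: i_def)
    hence "as ! (i - 1) < k"
      using nk[of "i - 1"] i(2) p by linarith
    moreover have "as ! i < N"
    proof -
      have "i < p" using i(2) p by linarith
      thus ?thesis using mem[of i] assms(1) by auto
    qed
    ultimately have "{k, Suc k mod N} \<subseteq> D i"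
      using i by (auto simp: D_def)
    moreover have "i \<in> {1..<p}"
      using i p \<open>i \<noteq> 0\<close> by auto
    ultimately show ?thesis unfolding blocks by blast
  qed
qed

lemma generating_allowed_iff:
  assumes "A \<subseteq> {..<N}"
  shows "generating_allowed N A B \<longleftrightarrow> B \<subset> {..<N} \<and>
     ((\<exists>a\<in>A. B = {a}) \<or> (\<exists>k<N. k \<notin> A \<and> B = {k, Suc k mod N}))"
  unfolding generating_allowed_def using pair_in_block[OF assms] by auto

text \<open>
  The automaton follows a given partition into generating subsets, its state at \<open>j\<close> telling whether
  the pair beginning at the cyclic predecessor of \<open>j\<close> belongs to the partition. This state has
  period \<open>N\<close>, so the run closes up.
\<close>

lemma allowed_imp_run:
  assumes A: "A \<subseteq> {..<N}" and B: "B \<in> allowed_subsets N A"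
  shows "\<exists>s. tile_run A B s N = Some s"
proof (cases "N = 0")
  case True
  thus ?thesis by auto
next
  case False
  from B obtain \<B> where part: "partition_on B \<B>" and gen: "\<And>G. G \<in> \<B> \<Longrightarrow> generating_allowed N A G"
    by (auto simp: allowed_subsets_def)
  have Un: "\<Union>\<B> = B" and disj: "\<And>G H. G \<in> \<B> \<Longrightarrow> H \<in> \<B> \<Longrightarrow> G \<inter> H \<noteq> {} \<Longrightarrow> G = H"
    using part by (auto simp: partition_on_def disjoint_def)
  have proper: "G \<subset> {..<N}" if "G \<in> \<B>" for G
    using gen[OF that] by (simp add: generating_allowed_def)
  define pre where "pre j = (j + N - 1) mod N" for j
  have Suc_pre: "Suc (pre j) mod N = j mod N" for j
  proof -
    have "Suc (pre j) mod N = Suc (j + N - 1) mod N"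
      unfolding pre_def by (simp add: mod_Suc_eq)
    thus ?thesis using False by simp
  qed
  have pre_Suc: "pre (Suc j) = j" if "j < N" for j
    using that by (simp add: pre_def)
  define D where "D = {j. j < N \<and> j \<notin> A \<and> {j, Suc j mod N} \<in> \<B>}"
  define e where "e j \<longleftrightarrow> pre j \<in> D" for j
  have "pre N = pre 0"
  proof -
    have "N + N - 1 = N - 1 + N" using False by simp
    thus ?thesis unfolding pre_def by simp
  qed
  hence "e 0 = e N"
    by (simp add: e_def)
  moreover have "tile_step A B j (e j) = Some (e (Suc j))" if j: "j < N" for j
  proof -
    have eS: "e (Suc j) \<longleftrightarrow> j \<in> D"
      by (simp add: e_def pre_Suc j)
    show ?thesis
    proof (cases "e j")
      case True
      hence G: "{pre j, j} \<in> \<B>"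
        using Suc_pre[of j] j by (auto simp: e_def D_def)
      have "j \<notin> D"
      proof
        assume "j \<in> D"
        hence H: "{j, Suc j mod N} \<in> \<B>" by (simp add: D_def)
        have "{pre j, j} = {j, Suc j mod N}"
          using disj[OF G H] by auto
        hence p: "pre j = Suc j mod N"
          by (auto simp: doubleton_eq_iff)
        \<comment> \<open>Going around in two steps means that \<open>N \<le> 2\<close>, and the pair is everything.\<close>
        have "j = Suc (Suc j) mod N"
          using Suc_pre[of j] j p by (simp add: mod_Suc_eq)
        hence "N \<le> 2"
          using j by (auto simp: mod_Suc split: if_splits)
        hence "{j, Suc j mod N} = {..<N}"
          using j by (auto simp: mod_Suc numeral_2_eq_2 less_Suc_eq le_Suc_eq split: if_splits)
        thus False using proper[OF H] by auto
      qed
      moreover have "j \<in> B"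
        using G Un by auto
      ultimately show ?thesis
        using True eS by simp
    next
      case no: False
      have "j \<in> D \<longleftrightarrow> j \<in> B \<and> j \<notin> A"
      proof
        assume "j \<in> D"
        thus "j \<in> B \<and> j \<notin> A" using Un by (auto simp: D_def)
      next
        assume jB: "j \<in> B \<and> j \<notin> A"
        then obtain G where G: "G \<in> \<B>" "j \<in> G"
          using Un by blast
        then obtain k where k: "k < N" "k \<notin> A" "G = {k, Suc k mod N}"
          using gen[OF G(1)] jB by (auto simp: generating_allowed_iff[OF A])
        hence kD: "k \<in> D" using G by (simp add: D_def)
        have "j \<noteq> Suc k mod N"
        proof
          assume "j = Suc k mod N"
          hence "pre j = k"
            using k(1) by (cases "Suc k = N") (auto simp: pre_def)
          thus False using no kD by (simp add: e_def)
        qed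
        thus "j \<in> D" using kD k G by auto
      qed
      thus ?thesis using no eS by simp
    qed
  qed
  ultimately show ?thesis
    unfolding tile_run_eq_Some_iff by (intro exI[of _ "e 0"] exI[of _ e]) auto
qed

text \<open>
  Conversely, a closed run describes a partition: a pair begins at each \<open>j\<close> after which the state
  is true, and the points of \<open>B\<close> outside these pairs are singletons, which must lie in \<open>A\<close> because
  no pair begins there.
\<close>

lemma run_imp_allowed:
  assumes A: "A \<subseteq> {..<N}" and B: "B \<subset> {..<N}" and run: "tile_run A B s N = Some s"
  shows "B \<in> allowed_subsets N A"
proof -
  obtain e where e: "e 0 = e N" and step: "\<And>j. j < N \<Longrightarrow> tile_step A B j (e j) = Some (e (Suc j))"
    using run unfolding tile_run_eq_Some_iff by auto
  have eT: "j \<in> B \<and> \<not> e (Suc j)" if "j < N" "e j" for j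
    using step[OF that(1)] that(2) by (auto split: if_splits)
  have eF: "e (Suc j) \<longleftrightarrow> j \<in> B \<and> j \<notin> A" if "j < N" "\<not> e j" for j
    using step[OF that(1)] that(2) by auto
  have eS: "j \<in> B \<and> j \<notin> A \<and> \<not> e j" if "j < N" "e (Suc j)" for j
    using eT[of j] eF[of j] that by blast
  have e_mod: "e (Suc j mod N) = e (Suc j)" if "j < N" for j
    using that e by (cases "Suc j = N") auto
  define P where "P = (\<lambda>j. {j, Suc j mod N}) ` {j. j < N \<and> e (Suc j)}"
  define S where "S = (\<lambda>a. {a}) ` {a \<in> B. \<not> e a \<and> \<not> e (Suc a)}"
  have lt: "j < N" if "j \<in> B" for j
    using that B by auto
  have P_mem: "x \<in> B" "(e (Suc x) \<and> G = {x, Suc x mod N}) \<or>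
      (e x \<and> (\<exists>j<N. x = Suc j mod N \<and> G = {j, x}))" if Gx: "G \<in> P" "x \<in> G" for G x
  proof -
    obtain j where j: "j < N" "e (Suc j)" "G = {j, Suc j mod N}"
      using Gx unfolding P_def by blast
    have "Suc j mod N < N" using j by simp
    show "x \<in> B"
      using that j eS[OF j(1,2)] eT[OF \<open>Suc j mod N < N\<close>] e_mod[OF j(1)] by auto
    show "(e (Suc x) \<and> G = {x, Suc x mod N}) \<or>
      (e x \<and> (\<exists>j<N. x = Suc j mod N \<and> G = {j, x}))"
      using that j e_mod[OF j(1)] by auto
  qed
  have pred_unique: "j = j'" if "j < N" "j' < N" "Suc j mod N = Suc j' mod N" for j j'
    using that by (auto simp: mod_Suc split: if_splits)
  have same: "G = H" if G: "G \<in> P \<union> S" "x \<in> G" and H: "H \<in> P \<union> S" "x \<in> H" for G H x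
  proof -
    have S_mem: "x \<in> B \<and> \<not> e x \<and> \<not> e (Suc x) \<and> G = {x}" if "G \<in> S" "x \<in> G" for G
      using that by (auto simp: S_def)
    show ?thesis
    proof (cases "G \<in> P")
      case True
      note 1 = P_mem[OF True G(2)]
      have "H \<in> P"
        using H S_mem[of H] 1 by blast
      note 2 = P_mem[OF this H(2)]
      have "\<not> (e x \<and> e (Suc x))"
        using eT[OF lt[OF 1(1)]] by blast
      thus ?thesis
        using 1 2 pred_unique by metis
    next
      case False
      hence "G \<in> S" using G by blast
      note 1 = S_mem[OF this G(2)]
      have "H \<in> S"
        using H P_mem(2)[of H x] 1 by blast
      thus ?thesis
        using 1 S_mem[OF _ H(2)] by blast
    qed
  qed
  have "partition_on B (P \<union> S)"
  proof (rule partition_onI)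
    show "\<Union>(P \<union> S) = B"
    proof
      show "\<Union>(P \<union> S) \<subseteq> B"
        using P_mem(1) by (auto simp: S_def)
      show "B \<subseteq> \<Union>(P \<union> S)"
      proof
        fix x assume x: "x \<in> B"
        note xN = lt[OF x]
        consider "e (Suc x)" | "e x" | "\<not> e x" "\<not> e (Suc x)" by blast
        thus "x \<in> \<Union>(P \<union> S)"
        proof cases
          case 1
          hence "{x, Suc x mod N} \<in> P" using xN by (auto simp: P_def)
          thus ?thesis by blast
        next
          case 2
          define j where "j = (if x = 0 then N - 1 else x - 1)"
          have j: "j < N" "Suc j mod N = x"
            using xN by (auto simp: j_def)
          hence "{j, x} \<in> P"
            using 2 e_mod[OF j(1)] by (force simp: P_def)
          thus ?thesis by blast
        next
          case 3
          hence "{x} \<in> S" using x by (auto simp: S_def)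
          thus ?thesis by blast
        qed
      qed
    qed
    show "disjnt G H" if "G \<in> P \<union> S" "H \<in> P \<union> S" "G \<noteq> H" for G H
      using same[OF that(1) _ that(2)] that(3) by (auto simp: disjnt_def)
    show "{} \<notin> P \<union> S"
      by (auto simp: P_def S_def)
  qed
  moreover have "generating_allowed N A G" if G: "G \<in> P \<union> S" for G
  proof -
    have "G \<subset> {..<N}"
    proof -
      have "G \<subseteq> B" using G P_mem(1) by (auto simp: S_def)
      thus ?thesis using B by blast
    qed
    moreover have "(\<exists>a\<in>A. G = {a}) \<or> (\<exists>k<N. k \<notin> A \<and> G = {k, Suc k mod N})"
    proof (cases "G \<in> P")
      case True
      thus ?thesis using eS by (auto simp: P_def)
    next
      case False
      then obtain a where "a \<in> B" "\<not> e a" "\<not> e (Suc a)" "G = {a}"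
        using G by (auto simp: S_def)
      thus ?thesis using eF[of a] lt[of a] by auto
    qed
    ultimately show ?thesis
      by (simp add: generating_allowed_iff[OF A])
  qed
  ultimately show ?thesis
    using B by (auto simp: allowed_subsets_def)
qed

text \<open>
  After a point that is outside \<open>B\<close> or in \<open>A\<close> the state is false, whatever it was before. So all
  runs that get past such a point agree from there on.
\<close>

lemma tile_run_merge:
  assumes "g < m" "g \<notin> B \<or> g \<in> A" "tile_run A B s m = Some t" "tile_run A B s' m = Some t'"
  shows "t = t'"
proof -
  have "Suc g \<le> m" using assms(1) by simp
  thus ?thesis
    using assms(3,4)
  proof (induction m arbitrary: t t' rule: dec_induct)
    case base
    have F: "v = False" if "tile_step A B g u = Some v" for u v
      using that assms(2) by (cases u) (auto split: if_splits)
    thus ?case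
      using base by (auto simp: bind_eq_Some_conv)
  next
    case (step m)
    obtain u u' where u: "tile_run A B s m = Some u" "tile_step A B m u = Some t"
        and u': "tile_run A B s' m = Some u'" "tile_step A B m u' = Some t'"
      using step.prems by (auto simp: bind_eq_Some_conv)
    have "u = u'" by (rule step.IH[OF u(1) u'(1)])
    thus ?case using u(2) u'(2) by simp
  qed
qed

lemma tile_run_full:
  assumes "{..<m} \<subseteq> B"
  shows "\<exists>t. tile_run A B s m = Some t"
  using assms
proof (induction m)
  case (Suc m)
  then obtain t where "tile_run A B s m = Some t" by force
  moreover have "m \<in> B" using Suc.prems by auto
  ultimately show ?case by (cases t) auto
qed auto

lemma tile_run_full_no_singletons:
  assumes "{..<m} \<subseteq> B"
  shows "tile_run {} B s m = Some (s \<noteq> odd m)"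
  using assms
proof (induction m)
  case (Suc m)
  have "{..<m} \<subseteq> B" using Suc.prems by auto
  hence "m \<in> B" "tile_run {} B s m = Some (s \<noteq> odd m)"
    using Suc by auto
  thus ?case by (cases "s \<noteq> odd m") auto
qed simp

text \<open>
  If some point lies outside \<open>B\<close> or in \<open>A\<close>, then all runs have the same final state, and at most
  one initial state gives a closed run. On the full set no run is ever blocked. So for \<open>A \<noteq> {}\<close> the
  common final state is the initial state of a closed run, while for \<open>A = {}\<close> the state alternates
  and both runs close up or neither does, according to the parity of \<open>N\<close>.
\<close>

lemma closed_runs_count:
  assumes N: "N \<ge> 1" and A: "A \<subseteq> {..<N}" and B: "B \<subseteq> {..<N}"
  shows "of_bool (tile_run A B False N = Some False) + of_bool (tile_run A B True N = Some True) =
    (of_bool (B \<in> allowed_subsets N A) :: int) +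
    of_bool (B = {..<N}) * (if A = {} then 1 + (-1) ^ N else 1)"
proof -
  have proper: "B \<noteq> {..<N}" if "B \<in> allowed_subsets N A"
    using that by (auto simp: allowed_subsets_def)
  show ?thesis
  proof (cases "B = {..<N}")
    case True
    hence nB: "B \<notin> allowed_subsets N A"
      using proper by blast
    show ?thesis
    proof (cases "A = {}")
      case True
      thus ?thesis
        using nB \<open>B = {..<N}\<close> tile_run_full_no_singletons[of N B]
        by (cases "even N") (auto simp del: not_not)
    next
      case False
      then obtain g where g: "g \<in> A" "g < N" using A by auto
      obtain t t' where "tile_run A B False N = Some t" "tile_run A B True N = Some t'"
        using tile_run_full[of N B] \<open>B = {..<N}\<close> by blast
      moreover from this have "t = t'"
        using tile_run_merge[OF g(2) disjI2[OF g(1)]] by blast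
      ultimately show ?thesis
        using nB False \<open>B = {..<N}\<close> by (cases t) auto
    qed
  next
    case False
    then obtain g where g: "g < N" "g \<notin> B" using B by blast
    have "\<not> (tile_run A B False N = Some False \<and> tile_run A B True N = Some True)"
      using tile_run_merge[OF g(1) disjI1[OF g(2)]] by blast
    moreover have "B \<in> allowed_subsets N A \<longleftrightarrow>
        tile_run A B False N = Some False \<or> tile_run A B True N = Some True"
    proof
      assume "B \<in> allowed_subsets N A"
      then obtain s where "tile_run A B s N = Some s"
        using allowed_imp_run[OF A] by blast
      thus "tile_run A B False N = Some False \<or> tile_run A B True N = Some True"
        by (cases s) auto
    qed (use run_imp_allowed[OF A] B False in blast)
    ultimately show ?thesis using False by auto
  qed
qed

lemma run_sum_trace:
  fixes X :: "nat \<Rightarrow> int"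
  assumes N: "N \<ge> 1" and A: "A \<subseteq> {..<N}"
  shows "run_sum A X False False N + run_sum A X True True N =
    P_poly N A X + (if A = {} then 1 + (-1) ^ N else 1)"
proof -
  let ?c = "if A = {} then 1 + (-1) ^ N else 1 :: int"
  have sub: "allowed_subsets N A \<subseteq> Pow {..<N}"
    by (auto simp: allowed_subsets_def)
  have "run_sum A X False False N + run_sum A X True True N =
     (\<Sum>B\<in>Pow {..<N}. of_bool (B \<in> allowed_subsets N A) * (\<Prod>i\<in>{..<N} - B. X i) +
        of_bool (B = {..<N}) * ?c)"
    unfolding run_sum_def sum.distrib[symmetric]
  proof (intro sum.cong refl)
    fix B assume "B \<in> Pow {..<N}"
    hence "B \<subseteq> {..<N}" by simp
    note * = closed_runs_count[OF N A this]
    have "of_bool (tile_run A B False N = Some False) * (\<Prod>i\<in>{..<N} - B. X i) +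
        of_bool (tile_run A B True N = Some True) * (\<Prod>i\<in>{..<N} - B. X i) =
        (of_bool (B \<in> allowed_subsets N A) + of_bool (B = {..<N}) * ?c) * (\<Prod>i\<in>{..<N} - B. X i)"
      unfolding distrib_right[symmetric] * ..
    also have "\<dots> = of_bool (B \<in> allowed_subsets N A) * (\<Prod>i\<in>{..<N} - B. X i) +
        of_bool (B = {..<N}) * ?c"
      by (simp add: algebra_simps)
    finally show "of_bool (tile_run A B False N = Some False) * (\<Prod>i\<in>{..<N} - B. X i) +
        of_bool (tile_run A B True N = Some True) * (\<Prod>i\<in>{..<N} - B. X i) = \<dots>" .
  qed
  also have "\<dots> = (\<Sum>B\<in>Pow {..<N}. of_bool (B \<in> allowed_subsets N A) * (\<Prod>i\<in>{..<N} - B. X i)) + ?c"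
  proof -
    have "(\<Sum>B\<in>Pow {..<N}. of_bool (B = {..<N}) * ?c) = (\<Sum>B\<in>Pow {..<N}. if B = {..<N} then ?c else 0)"
      by (intro sum.cong) auto
    also have "\<dots> = ?c"
      by (subst sum.delta) auto
    finally show ?thesis by (simp add: sum.distrib)
  qed
  also have "(\<Sum>B\<in>Pow {..<N}. of_bool (B \<in> allowed_subsets N A) * (\<Prod>i\<in>{..<N} - B. X i)) = P_poly N A X"
    unfolding P_poly_def using sub by (intro sum.mono_neutral_cong_right) auto
  finally show ?thesis .
qed

text \<open>
  In \<open>1 - tr Q + det Q\<close> the contribution of the full set to the trace is \<open>1 + det Q\<close>: for
  \<open>A = {}\<close> both are \<open>1 + (-1) ^ N\<close>, and otherwise \<open>det Q = 0\<close>.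
\<close>

lemma det_cyclic_mat_eq_P_poly:
  fixes X :: "nat \<Rightarrow> int"
  assumes N: "N \<ge> 1" and A: "A \<subseteq> {..<N}"
  shows "det (cyclic_mat N (\<lambda>j. X j + of_bool (j \<in> A)) (\<lambda>j. of_bool (j \<notin> A))) = - P_poly N A X"
proof -
  have "(\<Prod>j<N. - of_bool (j \<notin> A)) = (if A = {} then (-1) ^ N else 0 :: int)"
    using A by (auto intro!: prod_zero)
  thus ?thesis
    using det_cyclic_mat[OF N transfer_eq_run_sum[where s = False, simplified]
        transfer_eq_run_sum[where s = True, simplified], of X A]
      run_sum_det[of A X N] run_sum_trace[OF N A, of X]
    by simp
qed

section \<open>The matrix as a matrix of scalar products\<close>

lemma Suc_mod_cancel: "Suc a mod n = Suc b mod n \<longleftrightarrow> a mod n = b mod (n :: nat)"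
  using cong_add_rcancel_nat[of a 1 b n] by (simp add: cong_def)

text \<open>
  The coefficient of \<open>e\<^sub>x\<close> in \<open>D\<^sub>i\<close>. Basis vectors are counted with multiplicity, since an index may
  occur more than once among \<open>i, \<dots>, i + b\<^sub>i - 1\<close> modulo \<open>n\<close>.
\<close>

definition row_coeff :: "nat \<Rightarrow> (nat \<Rightarrow> nat) \<Rightarrow> nat \<Rightarrow> nat \<Rightarrow> int" where
  "row_coeff n b i x =
     of_bool (x = i) - (\<Sum>t\<in>{1..<b i}. of_bool ((i + t) mod n = x))"

definition row_product :: "nat \<Rightarrow> (nat \<Rightarrow> nat) \<Rightarrow> nat \<Rightarrow> nat \<Rightarrow> int" where
  "row_product n b i j = (\<Sum>x<n. row_coeff n b i x * row_coeff n b j x)"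

lemma row_product_commute: "row_product n b i j = row_product n b j i"
  by (simp add: row_product_def mult.commute)

lemma row_coeff_sum:
  assumes "i < n"
  shows "(\<Sum>x<n. g x * row_coeff n b i x) = g i - (\<Sum>t\<in>{1..<b i}. g ((i + t) mod n))"
proof -
  have "(\<Sum>x<n. g x * row_coeff n b i x) =
      (\<Sum>x<n. if x = i then g x else 0) -
      (\<Sum>x<n. \<Sum>t\<in>{1..<b i}. if (i + t) mod n = x then g x else 0)"
    unfolding sum_subtractf[symmetric] row_coeff_def right_diff_distrib sum_distrib_left
    by (intro sum.cong refl arg_cong2[where f = "(-)"]) auto
  also have "(\<Sum>x<n. if x = i then g x else 0) = g i"
    using assms by simp
  also have "(\<Sum>x<n. \<Sum>t\<in>{1..<b i}. if (i + t) mod n = x then g x else 0) =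
      (\<Sum>t\<in>{1..<b i}. \<Sum>x<n. if (i + t) mod n = x then g x else 0)"
    by (rule sum.swap)
  also have "\<dots> = (\<Sum>t\<in>{1..<b i}. g ((i + t) mod n))"
    using assms by (intro sum.cong refl) (subst sum.delta', auto)
  finally show ?thesis .
qed

lemma row_product_eq:
  assumes "j < n"
  shows "row_product n b i j =
    row_coeff n b i j - (\<Sum>t\<in>{1..<b j}. row_coeff n b i ((j + t) mod n))"
  unfolding row_product_def using row_coeff_sum[OF assms] .

text \<open>
  This is the scalar product of \<open>D\<^sub>i\<close> with \<open>e\<^sub>x - e\<^sub>x\<^sub>+\<^sub>1\<close>. Along the subtracted interval the
  coefficients are constant, and only its two ends survive. As the coefficients count
  multiplicities, this also holds for an interval that winds around the circle.
\<close>

lemma row_coeff_diff: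
  assumes "i < n" "x < n" "2 \<le> b i"
  shows "row_coeff n b i x - row_coeff n b i (Suc x mod n) =
    2 * of_bool (x = i) - of_bool (Suc x mod n = i) - of_bool ((i + (b i - 1)) mod n = x)"
proof -
  define h :: "nat \<Rightarrow> int" where "h t = of_bool ((i + t) mod n = x)" for t
  obtain m where m: "b i = Suc (Suc m)"
    using assms(3) by (metis Suc_le_D numeral_2_eq_2 Suc_le_mono)
  have "(\<Sum>t\<in>{1..<b i}. of_bool ((i + t) mod n = Suc x mod n)) = (\<Sum>t\<in>{1..<b i}. h (t - 1))"
  proof (intro sum.cong refl)
    fix t assume "t \<in> {1..<b i}"
    hence "(i + t) mod n = Suc x mod n \<longleftrightarrow> (i + (t - 1)) mod n = x"
      using Suc_mod_cancel[of "i + (t - 1)" n x] assms(2) by simp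
    thus "of_bool ((i + t) mod n = Suc x mod n) = h (t - 1)"
      by (simp add: h_def)
  qed
  also have "\<dots> = (\<Sum>t<Suc m. h t)"
    unfolding m by (rule sum.reindex_bij_witness[of _ Suc "\<lambda>t. t - 1"]) auto
  finally have 1: "(\<Sum>t\<in>{1..<b i}. of_bool ((i + t) mod n = Suc x mod n)) = h 0 + (\<Sum>t<m. h (Suc t))"
    by (simp only: sum.lessThan_Suc_shift)
  have "(\<Sum>t\<in>{1..<b i}. h t) = (\<Sum>t<Suc m. h (Suc t))"
    unfolding m by (rule sum.reindex_bij_witness[of _ Suc "\<lambda>t. t - 1"]) auto
  hence 2: "(\<Sum>t\<in>{1..<b i}. of_bool ((i + t) mod n = x)) = (\<Sum>t<m. h (Suc t)) + h (Suc m)"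
    by (simp add: h_def)
  have "h 0 = of_bool (x = i)" and "h (Suc m) = of_bool ((i + (b i - 1)) mod n = x)"
    using assms(1) by (auto simp: h_def m)
  thus ?thesis
    unfolding row_coeff_def 1 2 by simp
qed

lemma row_product_two:
  assumes "i < n" "j < n" "2 \<le> b i" "b j = 2"
  shows "row_product n b i j =
    2 * of_bool (i = j) - of_bool ((j + (b j - 1)) mod n = i) - of_bool ((i + (b i - 1)) mod n = j)"
proof -
  have "{1..<b j} = {1}"
    using assms(4) by auto
  thus ?thesis
    using row_product_eq[OF assms(2), of b i] row_coeff_diff[of i n j b] assms by auto
qed

text \<open>
  Beyond the subtracted interval, of length \<open>m + 1 \<le> n\<close>, the coefficients of \<open>D\<^sub>i\<close> vanish until the
  indices come around to \<open>i\<close> and then \<open>i + 1\<close>.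
\<close>

lemma row_coeff_far:
  assumes "2 \<le> n" "i < n" "b i = m + 2" "m + 1 \<le> n" "m + 2 \<le> y" "y \<le> n + 1"
  shows "row_coeff n b i ((i + y) mod n) = of_bool (y = n) - of_bool (y = n + 1)"
proof -
  have "(i + y) mod n = i \<longleftrightarrow> y = n"
  proof -
    have "(i + y) mod n = i \<longleftrightarrow> [i + y = i] (mod n)"
      using assms(2) by (simp add: cong_def)
    also have "\<dots> \<longleftrightarrow> [y = 0] (mod n)"
      by (rule cong_add_lcancel_0_nat)
    also have "\<dots> \<longleftrightarrow> n dvd y"
      by (simp add: cong_0_iff)
    also have "\<dots> \<longleftrightarrow> y = n"
    proof
      assume "n dvd y"
      then obtain c where c: "y = n * c" ..
      have "c \<noteq> 0" using c assms by (intro notI) simp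
      moreover have "c < 2"
      proof (rule ccontr)
        assume "\<not> c < 2"
        hence "n * 2 \<le> y" unfolding c by simp
        thus False using assms by linarith
      qed
      ultimately show "y = n" using c by (cases "c = 1") auto
    qed auto
    finally show ?thesis .
  qed
  moreover have "(\<Sum>t\<in>{1..<b i}. of_bool ((i + t) mod n = (i + y) mod n)) = (of_bool (y = n + 1) :: int)"
  proof -
    have "(i + t) mod n = (i + y) mod n \<longleftrightarrow> t = 1 \<and> y = n + 1" if t: "t \<in> {1..<b i}" for t
    proof -
      have ty: "t < y" "y - t \<le> n" using t assms by auto
      have "(i + t) mod n = (i + y) mod n \<longleftrightarrow> [i + y = i + t] (mod n)"
        by (auto simp: cong_def)
      also have "\<dots> \<longleftrightarrow> [y = t] (mod n)"
        by (rule cong_add_lcancel_nat)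
      also have "\<dots> \<longleftrightarrow> n dvd y - t"
        using ty by (simp add: cong_altdef_nat)
      also have "\<dots> \<longleftrightarrow> y - t = n"
        using ty by (auto dest: dvd_imp_le)
      also have "\<dots> \<longleftrightarrow> t = 1 \<and> y = n + 1"
        using t assms by auto
      finally show ?thesis .
    qed
    hence "(\<Sum>t\<in>{1..<b i}. of_bool ((i + t) mod n = (i + y) mod n)) =
        (\<Sum>t\<in>{1..<b i}. if t = 1 then of_bool (y = n + 1) else (0 :: int))"
      by (intro sum.cong refl) auto
    also have "\<dots> = of_bool (y = n + 1)"
      using assms by (subst sum.delta) auto
    finally show ?thesis .
  qed
  ultimately show ?thesis
    by (simp add: row_coeff_def)
qed

text \<open>
  Two entries larger than \<open>2\<close>, of which the second one comes \<open>d\<close> steps after the first one. The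
  bounds on \<open>d\<close> say that each has room for its own part of the sequence before the other one
  begins. The first two terms of \<open>D\<^sub>j\<close> are handled by \<open>row_coeff_diff\<close>, the others are beyond the
  subtracted interval of \<open>D\<^sub>i\<close>.
\<close>

lemma row_product_far:
  assumes n: "2 \<le> n" and i: "i < n" "b i = m + 2" "1 \<le> m" and j: "j < n" "b j = l + 2" "1 \<le> l"
    and d: "j = (i + d) mod n" "m \<le> d" "d + l \<le> n"
  shows "row_product n b i j =
    - of_bool ((i + (b i - 1)) mod n = j) - of_bool ((j + (b j - 1)) mod n = i)"
proof -
  have at: "(j + t) mod n = (i + (d + t)) mod n" for t
    unfolding d(1) by (simp add: mod_add_left_eq add.assoc)
  have hit: "(j + t) mod n = i \<longleftrightarrow> d + t = n" if t: "1 \<le> t" "t \<le> l + 1" for t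
  proof -
    have "(j + t) mod n = i \<longleftrightarrow> [i + (d + t) = i] (mod n)"
      using i(1) by (simp add: at cong_def)
    also have "\<dots> \<longleftrightarrow> n dvd d + t"
      by (simp add: cong_add_lcancel_0_nat cong_0_iff)
    also have "\<dots> \<longleftrightarrow> d + t = n"
    proof
      assume "n dvd d + t"
      then obtain c where c: "d + t = n * c" ..
      have "c \<noteq> 0" using c t by (intro notI) simp
      moreover have "c < 2"
      proof (rule ccontr)
        assume "\<not> c < 2"
        hence "n * 2 \<le> d + t" unfolding c by simp
        thus False using d t n by linarith
      qed
      ultimately show "d + t = n" using c by (cases "c = 1") auto
    qed auto
    finally show ?thesis .
  qed
  have ne: "j \<noteq> i"
  proof
    assume "j = i"
    hence "[i + d = i] (mod n)" using d(1) i(1) by (simp add: cong_def)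
    hence "n dvd d" by (simp add: cong_add_lcancel_0_nat cong_0_iff)
    thus False using d i j by (auto dest: dvd_imp_le)
  qed
  have "{1..<b j} = insert 1 {2..<l + 2}"
    using j by auto
  hence "row_product n b i j =
      (row_coeff n b i j - row_coeff n b i (Suc j mod n)) -
      (\<Sum>t\<in>{2..<l + 2}. row_coeff n b i ((j + t) mod n))"
    using row_product_eq[OF j(1), of b i] by simp
  also have "(\<Sum>t\<in>{2..<l + 2}. row_coeff n b i ((j + t) mod n)) =
      (\<Sum>t\<in>{2..<l + 2}. of_bool (d + t = n) - of_bool (d + t = n + 1))"
  proof (intro sum.cong refl)
    fix t assume "t \<in> {2..<l + 2}"
    thus "row_coeff n b i ((j + t) mod n) = of_bool (d + t = n) - of_bool (d + t = n + 1)"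
      unfolding at using d j by (intro row_coeff_far[where m = m] n i) auto
  qed
  also have "\<dots> = (\<Sum>t\<in>{1..<l + 1}. of_bool (d + Suc t = n) - of_bool (d + t = n))"
    by (rule sum.reindex_bij_witness[of _ Suc "\<lambda>t. t - 1"]) auto
  also have "\<dots> = of_bool (d + (l + 1) = n) - of_bool (d + 1 = n)"
    using sum_Suc_diff'[of 1 "l + 1" "\<lambda>t. of_bool (d + t = n) :: int"] by simp
  also have "row_coeff n b i j - row_coeff n b i (Suc j mod n) =
      - of_bool (d + 1 = n) - of_bool ((i + (b i - 1)) mod n = j)"
    using row_coeff_diff[OF i(1) j(1), of b] i ne hit[of 1] by simp
  finally show ?thesis
    using hit[of "l + 1"] j by simp
qed

text \<open>
  The \<open>m + 1\<close> subtracted indices wrap around to \<open>i\<close> itself if \<open>m + 1 = n\<close>, which cancels the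
  coefficient of \<open>e\<^sub>i\<close> and lowers the square by \<open>2\<close>. If \<open>m = n\<close>, the index \<open>i + 1\<close> is hit a second time
  as well; its coefficient \<open>- 2\<close> restores the value \<open>b i\<close>.
\<close>

lemma row_product_self:
  assumes n: "2 \<le> n" and i: "i < n" "b i = m + 2" "m \<le> n"
  shows "row_product n b i i = (if b i = n + 1 then int n - 1 else int (b i))"
proof -
  have eq: "(i + s) mod n = (i + t) mod n \<longleftrightarrow> s mod n = t mod n" for s t
    using cong_add_lcancel_nat[of i s t n] by (simp add: cong_def)
  have eq0: "(i + t) mod n = i \<longleftrightarrow> t mod n = 0" for t
    using eq[of t 0] i(1) by simp
  define g where "g t = (of_bool (t mod n = 0) - int (card {s\<in>{1..<m + 2}. s mod n = t mod n}))" for t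
  have coeff: "row_coeff n b i ((i + t) mod n) = g t" for t
  proof -
    have "(\<Sum>s\<in>{1..<m + 2}. of_bool (s mod n = t mod n)) =
        int (card ({1..<m + 2} \<inter> {s. s mod n = t mod n}))"
      by (subst sum_of_bool_eq) (auto simp del: sum.op_ivl_Suc)
    thus ?thesis
      unfolding row_coeff_def g_def i(2) eq eq0 by (simp add: Int_def)
  qed
  have form: "row_product n b i i = g 0 - (\<Sum>t\<in>{1..<m + 2}. g t)"
    using row_product_eq[OF i(1), of b i] coeff coeff[of 0] i by simp
  consider "m + 1 < n" | "m + 1 = n" | "m = n" using i(3) by linarith
  thus ?thesis
  proof cases
    case 1
    have "g 0 = 1"
      using 1 by (auto simp: g_def intro!: sum.neutral)
    moreover have "g t = -1" if "t \<in> {1..<m + 2}" for t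
    proof -
      have "{s\<in>{1..<m + 2}. s mod n = t mod n} = {t}"
        using 1 that by auto
      thus ?thesis using 1 that by (simp add: g_def)
    qed
    ultimately show ?thesis
      using 1 i by (simp add: form)
  next
    case 2
    have S: "{1..<m + 2} = insert n {1..<n}" using 2 n by auto
    have "{s\<in>{1..<m + 2}. s mod n = 0} = {n}"
      unfolding S using n by auto
    hence z: "g 0 = 0" "g n = 0"
      by (simp_all add: g_def)
    moreover have "g t = -1" if "t \<in> {1..<n}" for t
    proof -
      have "{s\<in>{1..<m + 2}. s mod n = t mod n} = {t}"
        unfolding S using that by auto
      thus ?thesis using that by (simp add: g_def)
    qed
    ultimately have "row_product n b i i = int n - 1"
      unfolding form unfolding S using n by simp
    thus ?thesis using 2 i by simp
  next
    case 3
    have S: "{1..<m + 2} = insert 1 (insert n (insert (n + 1) {2..<n}))" using 3 n by auto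
    have n1: "Suc n mod n = 1"
      using n by (simp add: mod_Suc)
    have not_dvd: "\<not> n dvd Suc n"
      using n1 by (metis dvd_imp_mod_0 zero_neq_one)
    have "{s\<in>{1..<m + 2}. s mod n = 0} = {n}"
      unfolding S using n not_dvd by auto
    hence z: "g 0 = 0" "g n = 0"
      by (simp_all add: g_def)
    have "{s\<in>{1..<m + 2}. s mod n = 1} = {1, n + 1}"
      unfolding S using n by (auto simp: mod_Suc)
    hence o: "g 1 = -2" "g (n + 1) = -2"
      using n by (simp_all add: g_def mod_Suc)
    have "g t = -1" if "t \<in> {2..<n}" for t
    proof -
      have "{s\<in>{1..<m + 2}. s mod n = t mod n} = {t}"
        unfolding S using that n n1 by auto
      thus ?thesis using that by (simp add: g_def)
    qed
    hence "(\<Sum>t\<in>{2..<n}. g t) = 2 - int n"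
      using n by simp
    hence "row_product n b i i = int n + 2"
      unfolding form unfolding S using n z o by simp
    thus ?thesis using 3 i by simp
  qed
qed

section \<open>The determinant of the factor\<close>

text \<open>
  The sequence, rotated so that its last entry is singular: \<open>q 0 < \<dots> < q (N - 1) = n - 1\<close> are the
  positions of the singular entries, \<open>b\<close> lists the entries, and \<open>q N\<close> stands for the first singular
  position one turn later. A regular sequence after the \<open>j\<close>-th singular one widens the gap after
  \<open>q j\<close> beyond \<open>k j\<close>. With this rotation the positions that share a class end in a singular
  position and do not wrap around, so the sum of the columns up to \<open>q l\<close> is the sum over the first
  \<open>l + 1\<close> classes.
\<close>

locale singular_positions =
  fixes n N :: nat and b q k :: "nat \<Rightarrow> nat" and A :: "nat set"
  assumes n: "2 \<le> n" and N: "1 \<le> N" and A: "A \<subseteq> {..<N}"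
    and k_pos: "j < N \<Longrightarrow> 1 \<le> k j"
    and gap: "j < N \<Longrightarrow> if j \<in> A then q j + k j < q (Suc j) else q (Suc j) = q j + k j"
    and q_last: "q (N - 1) = n - 1" and q_N: "q N = q 0 + n"
    and b_singular: "j < N \<Longrightarrow> b (q j) = k j + 2"
    and b_two: "i < n \<Longrightarrow> i \<notin> q ` {..<N} \<Longrightarrow> b i = 2"
begin

lemma gap_le: "j < N \<Longrightarrow> q j + k j \<le> q (Suc j)"
  using gap[of j] by (auto split: if_splits)

lemma q_add_le: "i < j \<Longrightarrow> j \<le> N \<Longrightarrow> q i + k i \<le> q j"
proof (induction j)
  case (Suc j)
  show ?case
  proof (cases "i = j")
    case True
    thus ?thesis using gap_le[of j] Suc.prems by simp
  next
    case False
    thus ?thesis using gap_le[of j] Suc by simp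
  qed
qed simp

lemma q_less: "i < j \<Longrightarrow> j \<le> N \<Longrightarrow> q i < q j"
  using q_add_le[of i j] k_pos[of i] by simp

lemma q_le_iff: "i < N \<Longrightarrow> j < N \<Longrightarrow> q i \<le> q j \<longleftrightarrow> i \<le> j"
  using q_less[of i j] q_less[of j i] by (cases i j rule: linorder_cases) auto

lemma q_strict_mono: "strict_mono_on {..<N} q"
  by (rule strict_mono_onI) (auto intro: q_less)

lemma q_lt_n: "j < N \<Longrightarrow> q j < n"
  using q_le_iff[of j "N - 1"] q_last N n by auto

lemma b_ge_two: "i < n \<Longrightarrow> 2 \<le> b i"
  using b_two[of i] b_singular by (cases "i \<in> q ` {..<N}") auto

lemma row_product_distinct:
  assumes ij: "i < n" "j < n" "i \<noteq> j"
  shows "row_product n b i j =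
    - of_bool ((i + (b i - 1)) mod n = j) - of_bool ((j + (b j - 1)) mod n = i)"
proof -
  consider "b j = 2" | "b i = 2" | "i \<in> q ` {..<N}" "j \<in> q ` {..<N}"
    using b_two ij by blast
  thus ?thesis
  proof cases
    case 1
    thus ?thesis
      using row_product_two[where b = b, OF ij(1,2) b_ge_two[OF ij(1)]] ij(3) by simp
  next
    case 2
    thus ?thesis
      using row_product_two[where b = b, OF ij(2,1) b_ge_two[OF ij(2)]] ij(3)
      by (simp add: row_product_commute[of n b i j])
  next
    case 3
    then obtain u v where u: "u < N" "i = q u" and v: "v < N" "j = q v"
      by auto
    have bk: "b i = k u + 2" "b j = k v + 2" "1 \<le> k u" "1 \<le> k v"
      using u v b_singular k_pos by auto
    show ?thesis
    proof (cases "u < v")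
      case True
      have "q u + k u \<le> q v" using q_add_le[OF True] v by simp
      moreover have "q v + k v \<le> q N" using q_add_le[of v N] v by simp
      moreover have "q 0 \<le> q u" using q_le_iff[of 0 u] u by auto
      ultimately have "k u \<le> j - i" "j - i + k v \<le> n" "j = (i + (j - i)) mod n"
        using u v q_N ij by auto
      thus ?thesis
        by (intro row_product_far[OF n ij(1) bk(1,3) ij(2) bk(2,4)])
    next
      case False
      hence uv: "v < u" using ij u v by (cases u v rule: linorder_cases) auto
      have "q v + k v \<le> q u" using q_add_le[OF uv] u by simp
      moreover have "q u + k u \<le> q N" using q_add_le[of u N] u by simp
      moreover have "q 0 \<le> q v" using q_le_iff[of 0 v] v by auto
      ultimately have "k u \<le> n + j - i" "n + j - i + k v \<le> n" "j = (i + (n + j - i)) mod n"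
        using u v q_N ij by auto
      thus ?thesis
        by (intro row_product_far[OF n ij(1) bk(1,3) ij(2) bk(2,4)])
    qed
  qed
qed

lemma row_product_diag:
  assumes i: "i < n"
  shows "row_product n b i i = (if b i = n + 1 then int n - 1 else int (b i))"
proof (cases "i \<in> q ` {..<N}")
  case True
  then obtain j where j: "j < N" "i = q j" by auto
  have "q 0 \<le> q j" using q_le_iff[of 0 j] j by auto
  hence "k j \<le> n" using q_add_le[of j N] q_N j by simp
  thus ?thesis
    using row_product_self[OF n i] b_singular j by simp
next
  case False
  hence "b i = 0 + 2" using b_two i by simp
  thus ?thesis
    using row_product_self[OF n i, of b 0] n by simp
qed

definition row_mat :: "int mat" where
  "row_mat = mat n n (\<lambda>(i, x). row_coeff n b i x)"

lemma det_row_product: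
  "det (mat n n (\<lambda>(i, j). row_product n b i j)) = (det row_mat)\<^sup>2"
proof -
  have C: "row_mat \<in> carrier_mat n n"
    by (simp add: row_mat_def)
  have "mat n n (\<lambda>(i, j). row_product n b i j) = row_mat * row_mat\<^sup>T"
    using C by (intro eq_matI)
      (auto simp: row_mat_def row_product_def scalar_prod_def atLeast0LessThan)
  thus ?thesis
    using det_mult[OF C, of "row_mat\<^sup>T"] C det_transpose[OF C] by (simp add: power2_eq_square)
qed

lemma partial_sum_row_coeff:
  assumes "i < n" "l < n"
  shows "(\<Sum>x\<le>l. row_coeff n b i x) = of_bool (i \<le> l) - (\<Sum>t\<in>{1..<b i}. of_bool ((i + t) mod n \<le> l))"
proof -
  have "(\<Sum>x\<le>l. row_coeff n b i x) = (\<Sum>x<n. of_bool (x \<le> l) * row_coeff n b i x)"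
    using assms by (intro sum.mono_neutral_cong_left) auto
  thus ?thesis
    using row_coeff_sum[OF assms(1), of "\<lambda>x. of_bool (x \<le> l)" b] by simp
qed

lemma last_singular: "n - 1 \<in> q ` {..<N}"
  using q_last N by (metis diff_less imageI lessThan_iff less_numeral_extra(1) less_le_trans)

text \<open>
  The partial sums of \<open>e\<^sub>i - e\<^sub>i\<^sub>+\<^sub>1\<close> form a unit row, unless \<open>i + 1\<close> wraps around. The last entry is
  singular, which excludes this case.
\<close>

lemma partial_sum_two:
  assumes i: "i < n" "i \<notin> q ` {..<N}" and l: "l < n"
  shows "(\<Sum>x\<le>l. row_coeff n b i x) = of_bool (i = l)"
proof -
  have "i \<noteq> n - 1"
    using i last_singular by auto
  moreover have "{1..<b i} = {1}"
    using b_two[OF i] by auto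
  ultimately show ?thesis
    using partial_sum_row_coeff[OF i(1) l] i by auto
qed

text \<open>
  The \<open>k j\<close> positions after the \<open>j\<close>-th singular one, and also the next position if a regular sequence
  follows, belong to the class of the singular entry \<open>j + 1\<close>. Comparing with all \<open>q l\<close> determines
  the class of a position.
\<close>

lemma after_singular_le_iff:
  assumes j: "j < N" and l: "l < N" and t: "1 \<le> t" "t \<le> k j \<or> (j \<in> A \<and> t \<le> k j + 1)"
  shows "(q j + t) mod n \<le> q l \<longleftrightarrow> Suc j mod N \<le> l"
proof -
  have le: "q j + t \<le> q (Suc j)"
    using gap[OF j] t by (auto split: if_splits)
  show ?thesis
  proof (cases "Suc j = N")
    case True
    hence "q j = n - 1" using q_last by auto
    hence "q j + t = n + (t - 1)" "t - 1 \<le> q 0"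
      using le True q_N t n by auto
    moreover from this have "t - 1 < n"
      using q_lt_n[of 0] N by simp
    ultimately have "(q j + t) mod n = t - 1" by simp
    moreover have "q 0 \<le> q l" using q_le_iff[of 0 l] l by simp
    ultimately show ?thesis
      using \<open>t - 1 \<le> q 0\<close> True by simp
  next
    case False
    hence Sj: "Suc j < N" using j by simp
    have "q j + t < n" using le q_lt_n[OF Sj] by simp
    hence "(q j + t) mod n = q j + t" by simp
    moreover have "q j + t \<le> q l \<longleftrightarrow> Suc j \<le> l"
    proof
      assume "q j + t \<le> q l"
      hence "\<not> q l \<le> q j" using t by simp
      thus "Suc j \<le> l" using q_le_iff[OF l j] by simp
    next
      assume "Suc j \<le> l"
      thus "q j + t \<le> q l" using le q_le_iff[OF Sj l] by simp
    qed
    ultimately show ?thesis using Sj by simp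
  qed
qed

text \<open>
  If no regular sequence follows, position \<open>q j + k j\<close> is the next singular one, and the position
  after it belongs to the class of the singular entry \<open>j + 2\<close>.
\<close>

lemma after_two_singular_le_iff:
  assumes j: "j < N" "j \<notin> A" and l: "l < N"
  shows "(q j + (k j + 1)) mod n \<le> q l \<longleftrightarrow> Suc (Suc j) mod N \<le> l"
proof -
  define j' where "j' = Suc j mod N"
  have j': "j' < N" using N by (simp add: j'_def)
  have qS: "q (Suc j) mod n = q j'"
  proof (cases "Suc j = N")
    case True
    thus ?thesis using q_N q_lt_n[of 0] N by (simp add: j'_def)
  next
    case False
    thus ?thesis using j q_lt_n[of "Suc j"] by (simp add: j'_def)
  qed
  have "q j + (k j + 1) = q (Suc j) + 1"
    using gap[OF j(1)] j by simp
  hence "(q j + (k j + 1)) mod n = (q j' + 1) mod n"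
    using qS by (metis mod_add_left_eq)
  moreover have "Suc j' mod N = Suc (Suc j) mod N"
    by (simp add: j'_def mod_Suc_eq)
  ultimately show ?thesis
    using after_singular_le_iff[OF j' l, of 1] k_pos[OF j'] by simp
qed

abbreviation reduced_entry :: "nat \<Rightarrow> nat \<Rightarrow> int" where
  "reduced_entry j c \<equiv> of_bool (c = j) - (int (k j) + of_bool (j \<in> A)) * of_bool (c = Suc j mod N)
     - of_bool (j \<notin> A) * of_bool (c = Suc (Suc j) mod N)"

text \<open>
  The surviving rows are those of the recurrence
  \<open>g\<^sub>j = (k\<^sub>j + [j \<in> A]) g\<^sub>j\<^sub>+\<^sub>1 + [j \<notin> A] g\<^sub>j\<^sub>+\<^sub>2\<close>, again with partial sums over the columns.
\<close>

lemma partial_sum_singular: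
  assumes j: "j < N" and l: "l < N"
  shows "(\<Sum>x\<le>q l. row_coeff n b (q j) x) = (\<Sum>c\<le>l. reduced_entry j c)"
proof -
  have bj: "{1..<b (q j)} = insert (k j + 1) {1..<k j + 1}"
    using b_singular[OF j] by auto
  have "(\<Sum>t\<in>{1..<k j + 1}. of_bool ((q j + t) mod n \<le> q l)) =
      (\<Sum>t\<in>{1..<k j + 1}. of_bool (Suc j mod N \<le> l) :: int)"
    by (intro sum.cong refl) (use after_singular_le_iff[OF j l] in auto)
  also have "\<dots> = int (k j) * of_bool (Suc j mod N \<le> l)"
    by (simp only: sum_constant card_atLeastLessThan add_diff_cancel_right')
  finally have first: "(\<Sum>t\<in>{1..<k j + 1}. of_bool ((q j + t) mod n \<le> q l)) =
      int (k j) * of_bool (Suc j mod N \<le> l)" .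
  have last: "of_bool ((q j + (k j + 1)) mod n \<le> q l) =
      (if j \<in> A then of_bool (Suc j mod N \<le> l) else of_bool (Suc (Suc j) mod N \<le> l) :: int)"
    using after_singular_le_iff[OF j l, of "k j + 1"] after_two_singular_le_iff[OF j _ l] by auto
  have "(\<Sum>t\<in>{1..<b (q j)}. of_bool ((q j + t) mod n \<le> q l)) =
      of_bool ((q j + (k j + 1)) mod n \<le> q l) +
      (\<Sum>t\<in>{1..<k j + 1}. of_bool ((q j + t) mod n \<le> q l) :: int)"
    unfolding bj by (rule sum.insert) auto
  hence "(\<Sum>x\<le>q l. row_coeff n b (q j) x) = of_bool (j \<le> l)
      - (int (k j) + of_bool (j \<in> A)) * of_bool (Suc j mod N \<le> l)
      - of_bool (j \<notin> A) * of_bool (Suc (Suc j) mod N \<le> l)"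
    unfolding first last partial_sum_row_coeff[OF q_lt_n[OF j] q_lt_n[OF l]] q_le_iff[OF j l]
    by (simp add: algebra_simps)
  also have "\<dots> = (\<Sum>c\<le>l. reduced_entry j c)"
  proof -
    have delta: "(\<Sum>c\<le>l. w * of_bool (c = a)) = w * of_bool (a \<le> l)" for a :: nat and w :: int
    proof -
      have "(\<Sum>c\<le>l. w * of_bool (c = a)) = (\<Sum>c\<le>l. if c = a then w else 0)"
        by (intro sum.cong) auto
      thus ?thesis by simp
    qed
    show ?thesis
      unfolding sum_subtractf delta delta[of 1, simplified mult_1] ..
  qed
  finally show ?thesis .
qed

lemma det_row_mat: "det row_mat = - P_poly N A (\<lambda>j. int (k j))"
proof -
  let ?S = "mat n n (\<lambda>(i, l). \<Sum>x\<le>l. row_coeff n b i x)"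
  have "det row_mat = det ?S"
    unfolding row_mat_def by (rule det_column_sums[symmetric])
  also have "\<dots> = det (mat N N (\<lambda>(r, c). ?S $$ (q r, q c)))"
  proof (rule det_unit_rows)
    show "q ` {..<N} \<subseteq> {..<n}" using q_lt_n by auto
    fix i c assume "i < n" "i \<notin> q ` {..<N}" "c < n"
    thus "?S $$ (i, c) = of_bool (i = c)"
      using partial_sum_two by simp
  qed (simp_all add: q_strict_mono)
  also have "mat N N (\<lambda>(r, c). ?S $$ (q r, q c)) =
      mat N N (\<lambda>(j, l). \<Sum>c\<le>l. reduced_entry j c)"
    using q_lt_n partial_sum_singular by (intro eq_matI) auto
  also have "det \<dots> = det (mat N N (\<lambda>(j, c). reduced_entry j c))"
    by (rule det_column_sums)
  also have "mat N N (\<lambda>(j, c). reduced_entry j c) =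
      cyclic_mat N (\<lambda>j. int (k j) + of_bool (j \<in> A)) (\<lambda>j. of_bool (j \<notin> A))"
    by (simp add: cyclic_mat_def)
  also have "det \<dots> = - P_poly N A (\<lambda>j. int (k j))"
    by (rule det_cyclic_mat_eq_P_poly[OF N A])
  finally show ?thesis .
qed

lemma det_row_product_eq_P_poly:
  "det (mat n n (\<lambda>(i, j). row_product n b i j)) = (P_poly N A (\<lambda>j. int (k j)))\<^sup>2"
  by (simp add: det_row_product det_row_mat)

end

section \<open>From the sequence to the positions of its singular entries\<close>

lemma rotation_permutes:
  "(\<lambda>x. if x < n then (x + s) mod n else x) permutes {0..<n :: nat}" (is "?\<pi> permutes _")
proof (rule bij_imp_permutes)
  have inj: "inj_on ?\<pi> {0..<n}"
  proof (rule inj_onI)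
    fix x y assume "x \<in> {0..<n}" "y \<in> {0..<n}" "?\<pi> x = ?\<pi> y"
    thus "x = y"
      using cong_add_rcancel_nat[of x s y n] by (simp add: cong_def)
  qed
  moreover have "?\<pi> ` {0..<n} \<subseteq> {0..<n}"
    by auto
  ultimately show "bij_betw ?\<pi> {0..<n} {0..<n}"
    unfolding bij_betw_def using endo_inj_surj[of "{0..<n}" ?\<pi>] by blast
qed auto

text \<open>
  Whether \<open>i\<close> points to \<open>j\<close> depends only on \<open>j - i\<close> modulo \<open>n\<close> and on the entry at \<open>i\<close>, so rotating
  the sequence permutes the rows and columns of the matrix simultaneously.
\<close>

lemma (in singular_positions) det_rotated_seq_matrix:
  assumes len: "length a = n" and a: "\<And>i. i < n \<Longrightarrow> a ! ((i + s) mod n) = int (b i)"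
  shows "det (seq_matrix a) = (P_poly N A (\<lambda>j. int (k j)))\<^sup>2"
proof -
  define \<pi> where "\<pi> x = (if x < n then (x + s) mod n else x)" for x
  have \<pi>: "\<pi> permutes {0..<n}"
    unfolding \<pi>_def[abs_def] by (rule rotation_permutes)
  have \<pi>_lt: "\<pi> i < n" if "i < n" for i
    using that by (simp add: \<pi>_def)
  have \<pi>_eq: "\<pi> i = \<pi> j \<longleftrightarrow> i = j" for i j
    using permutes_inj[OF \<pi>] by (auto dest: injD)
  have a\<pi>: "a ! \<pi> i = int (b i)" if "i < n" for i
    using a[OF that] that by (simp add: \<pi>_def)
  have points: "points_to a (\<pi> i) (\<pi> j) \<longleftrightarrow> (i + (b i - 1)) mod n = j" if "i < n" "j < n" for i j
  proof -
    have "int (\<pi> i) + a ! \<pi> i - 1 = int (\<pi> i + (b i - 1))"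
      using a\<pi>[OF that(1)] b_ge_two[OF that(1)] by simp
    hence "points_to a (\<pi> i) (\<pi> j) \<longleftrightarrow> [\<pi> j = \<pi> i + (b i - 1)] (mod n)"
      by (simp only: points_to_def len cong_int_iff)
    also have "\<dots> \<longleftrightarrow> [j + s = (i + s) + (b i - 1)] (mod n)"
      using that by (simp add: \<pi>_def cong_def mod_add_left_eq)
    also have "(i + s) + (b i - 1) = (i + (b i - 1)) + s"
      by simp
    also have "[j + s = (i + (b i - 1)) + s] (mod n) \<longleftrightarrow> [j = i + (b i - 1)] (mod n)"
      by (rule cong_add_rcancel_nat)
    also have "\<dots> \<longleftrightarrow> (i + (b i - 1)) mod n = j"
      using that by (auto simp: cong_def)
    finally show ?thesis .
  qed
  have "seq_matrix a \<in> carrier_mat n n"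
    by (simp add: seq_matrix_def len)
  hence "det (seq_matrix a) = det (mat n n (\<lambda>(i, j). seq_matrix a $$ (\<pi> i, \<pi> j)))"
    by (rule det_simultaneous_permutation[OF _ \<pi>, symmetric])
  also have "mat n n (\<lambda>(i, j). seq_matrix a $$ (\<pi> i, \<pi> j)) =
      mat n n (\<lambda>(i, j). row_product n b i j)"
  proof (rule cong_mat)
    fix i j assume ij: "i < n" "j < n"
    show "(case (i, j) of (i, j) \<Rightarrow> seq_matrix a $$ (\<pi> i, \<pi> j)) =
        (case (i, j) of (i, j) \<Rightarrow> row_product n b i j)"
    proof (cases "i = j")
      case True
      thus ?thesis
        using ij \<pi>_lt a\<pi> row_product_diag[OF ij(1)]
        by (simp add: seq_matrix_def len diag_entry_def)
    next
      case False
      thus ?thesis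
        using ij \<pi>_lt \<pi>_eq points row_product_distinct[OF ij False]
        by (simp add: seq_matrix_def len)
    qed
  qed auto
  finally show ?thesis
    by (simp add: det_row_product_eq_P_poly)
qed

definition offset :: "'a list list \<Rightarrow> nat \<Rightarrow> nat" where
  "offset xss i = length (concat (take i xss))"

lemma offset_Suc: "i < length xss \<Longrightarrow> offset xss (Suc i) = offset xss i + length (xss ! i)"
  by (simp add: offset_def take_Suc_conv_app_nth)

lemma offset_mono: "i \<le> j \<Longrightarrow> offset xss i \<le> offset xss j"
proof (induction j rule: dec_induct)
  case (step j)
  thus ?case
    by (cases "j < length xss") (auto simp: offset_Suc, simp add: offset_def)
qed simp

lemma offset_length: "offset xss (length xss) = length (concat xss)"
  by (simp add: offset_def)

lemma nth_concat_offset: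
  assumes "i < length xss" "t < length (xss ! i)"
  shows "concat xss ! (offset xss i + t) = xss ! i ! t"
proof -
  have "concat xss = concat (take i xss) @ xss ! i @ concat (drop (Suc i) xss)"
    using id_take_nth_drop[OF assms(1)] by (metis concat.simps(2) concat_append)
  thus ?thesis
    using assms(2) by (simp add: offset_def nth_append)
qed

lemma offset_split:
  assumes "x < length (concat xss)"
  obtains i t where "i < length xss" "t < length (xss ! i)" "x = offset xss i + t"
proof -
  define i where "i = (LEAST i. x < offset xss (Suc i))"
  have ne: "xss \<noteq> []" using assms by auto
  hence ex: "x < offset xss (Suc (length xss - 1))"
    using assms by (simp add: offset_length)
  have i: "x < offset xss (Suc i)"
    unfolding i_def using ex by (rule LeastI)
  have "i \<le> length xss - 1"
    unfolding i_def using ex by (rule Least_le)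
  hence il: "i < length xss"
    using ne by (cases xss) auto
  have "offset xss i \<le> x"
  proof (cases i)
    case 0
    thus ?thesis by (simp add: offset_def)
  next
    case (Suc i')
    thus ?thesis
      using not_less_Least[of i' "\<lambda>i. x < offset xss (Suc i)"] by (simp add: i_def)
  qed
  thus thesis
    using that[of i "x - offset xss i"] i il by (auto simp: offset_Suc)
qed

lemma length_singular_seq [simp]: "1 \<le> k \<Longrightarrow> length (singular_seq k) = k"
  by (simp add: singular_seq_def)

lemma nth_singular_seq:
  "t < length (singular_seq k) \<Longrightarrow> singular_seq k ! t = (if t = 0 then int k + 2 else 2)"
  by (cases t) (auto simp: singular_seq_def)

lemma regular_not_singular: "is_regular s \<Longrightarrow> \<not> is_singular s"
proof
  assume "is_regular s" "is_singular s"
  then obtain m k where "m \<ge> 1" "s = regular_seq m" "k \<ge> 1" "s = singular_seq k"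
    by (auto simp: is_regular_def is_singular_def)
  thus False
    by (cases m) (auto simp: regular_seq_def singular_seq_def)
qed

theorem theorem4p32:
  fixes \<sigma> :: "int list list" and N \<rho> :: nat
    and ipos :: "nat \<Rightarrow> nat" and k :: "nat \<Rightarrow> nat" and A :: "nat set"
  assumes "N \<ge> 1" and "\<rho> \<le> N"
    and "length \<sigma> = N + \<rho>"
    and "strict_mono_on {..<N} ipos"
    and "ipos ` {..<N} = {i. i < N + \<rho> \<and> is_singular (\<sigma> ! i)}"
    and "\<And>j. j < N \<Longrightarrow> k j \<ge> 1 \<and> \<sigma> ! ipos j = singular_seq (k j)"
    and "card {i. i < N + \<rho> \<and> is_regular (\<sigma> ! i)} = \<rho>"
    and "\<And>i. i < N + \<rho> \<Longrightarrow> is_singular (\<sigma> ! i) \<or> is_regular (\<sigma> ! i)"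
    and "\<And>i. i < N + \<rho> \<Longrightarrow> is_regular (\<sigma> ! i) \<Longrightarrow>
           is_singular (\<sigma> ! ((i + N + \<rho> - 1) mod (N + \<rho>))) \<and>
           is_singular (\<sigma> ! ((i + 1) mod (N + \<rho>)))"
    and "length (concat \<sigma>) \<ge> 2"
    and "A = {j. j < N \<and> is_regular (\<sigma> ! ((ipos j + 1) mod (N + \<rho>)))}"
  shows "det (seq_matrix (concat \<sigma>)) = (P_poly N A (\<lambda>j. int (k j)))\<^sup>2"
proof -
  define L where "L = N + \<rho>"
  define a where "a = concat \<sigma>"
  define n where "n = length a"
  note N = assms(1) and mono = assms(4) and k = assms(6)
  have len: "length \<sigma> = L" and sing: "ipos ` {..<N} = {i. i < L \<and> is_singular (\<sigma> ! i)}"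
    and cases_\<sigma>: "\<And>i. i < L \<Longrightarrow> is_singular (\<sigma> ! i) \<or> is_regular (\<sigma> ! i)"
    and A: "A = {j. j < N \<and> is_regular (\<sigma> ! (Suc (ipos j) mod L))}"
    using assms by (simp_all add: L_def)
  have n2: "2 \<le> n" using assms(10) by (simp add: n_def a_def)
  have L: "0 < L" using N by (simp add: L_def)
  have ipos_lt: "ipos j < L" if "j < N" for j
    using sing that by auto
  have ipos_less: "ipos i < ipos j \<longleftrightarrow> i < j" if "i < N" "j < N" for i j
    using strict_mono_on_less[OF mono] that by simp
  have nonempty: "1 \<le> length (\<sigma> ! i)" if "i < L" for i
    using cases_\<sigma>[OF that] by (auto simp: is_singular_def is_regular_def regular_seq_def)
  have off_Suc: "offset \<sigma> (Suc i) = offset \<sigma> i + length (\<sigma> ! i)" if "i < L" for i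
    using offset_Suc that len by metis
  have off_L: "offset \<sigma> L = n"
    using offset_length[of \<sigma>] by (simp add: len n_def a_def)
  have off_strict: "offset \<sigma> i < offset \<sigma> j" if "i < j" "j \<le> L" for i j
    using offset_mono[of "Suc i" j \<sigma>] off_Suc[of i] nonempty[of i] that by simp
  \<comment> \<open>The positions of the singular entries, with \<open>p N\<close> one turn after \<open>p 0\<close>.\<close>
  define p where "p j = (if j < N then offset \<sigma> (ipos j) else offset \<sigma> (ipos 0) + n)" for j
  have off_next: "offset \<sigma> (Suc (ipos j)) = p j + k j" if "j < N" for j
    using off_Suc[OF ipos_lt[OF that]] k[OF that] that by (simp add: p_def)
  have p_lt: "p j < n" if "j < N" for j
    using off_strict[of "ipos j" L] ipos_lt[OF that] off_L that by (simp add: p_def)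
  \<comment> \<open>The next singular entry comes right after the \<open>j\<close>-th singular sequence exactly when this one is
    not followed by a regular sequence. For \<open>j = N - 1\<close> the next one is found one turn later.\<close>
  have p_gap: "if j \<in> A then p j + k j < p (Suc j) else p (Suc j) = p j + k j" if j: "j < N" for j
  proof (cases "j \<in> A")
    case True
    hence reg: "is_regular (\<sigma> ! (Suc (ipos j) mod L))" by (simp add: A)
    have not_ipos: "ipos i \<noteq> Suc (ipos j) mod L" if "i < N" for i
      using sing that reg regular_not_singular by force
    have "offset \<sigma> (Suc (ipos j)) < p (Suc j)"
    proof (cases "Suc j < N")
      case True
      have "ipos j < ipos (Suc j)" using ipos_less[OF j True] by simp
      moreover have "ipos (Suc j) \<noteq> Suc (ipos j)"
        using not_ipos[OF True] calculation ipos_lt[OF True] by auto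
      ultimately show ?thesis
        using off_strict[of "Suc (ipos j)" "ipos (Suc j)"] ipos_lt[OF True] True
        by (simp add: p_def)
    next
      case last: False
      show ?thesis
      proof (cases "Suc (ipos j) < L")
        case True
        thus ?thesis
          using off_strict[of "Suc (ipos j)" L] off_L last by (simp add: p_def)
      next
        case False
        hence "Suc (ipos j) = L" using ipos_lt[OF j] by simp
        moreover from this have "0 < ipos 0"
          using not_ipos[of 0] N by simp
        moreover have "ipos 0 \<le> L" using ipos_lt[of 0] N by simp
        ultimately show ?thesis
          using off_strict[of 0 "ipos 0"] off_L last by (simp add: p_def)
      qed
    qed
    thus ?thesis using True off_next[OF j] by simp
  next
    case False
    have "Suc (ipos j) mod L < L" using L by simp
    moreover from this have "is_singular (\<sigma> ! (Suc (ipos j) mod L))"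
      using False j cases_\<sigma> by (auto simp: A)
    ultimately obtain v where v: "v < N" "Suc (ipos j) mod L = ipos v"
      using sing by (metis (mono_tags, lifting) imageE lessThan_iff mem_Collect_eq)
    have "p (Suc j) = offset \<sigma> (Suc (ipos j))"
    proof (cases "Suc (ipos j) = L")
      case True
      have "\<not> Suc j < N"
        using ipos_less[of j "Suc j"] ipos_lt[of "Suc j"] True j by auto
      moreover have "ipos 0 = 0"
        using v True ipos_less[of 0 v] N by (cases "v = 0") auto
      ultimately show ?thesis
        using True off_L by (simp add: p_def offset_def)
    next
      case False
      hence v': "Suc (ipos j) = ipos v" using v ipos_lt[OF j] by simp
      hence "j < v" using ipos_less[OF j v(1)] by simp
      hence Sj: "Suc j < N" using v by simp
      have "\<not> ipos (Suc j) < ipos v"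
        using v' ipos_less[OF j Sj] by simp
      hence "v = Suc j"
        using ipos_less[OF Sj v(1)] \<open>j < v\<close> by simp
      thus ?thesis using v' Sj by (simp add: p_def)
    qed
    thus ?thesis using False off_next[OF j] by simp
  qed
  \<comment> \<open>Shifting positions by \<open>d\<close> brings the last singular entry to position \<open>n - 1\<close>; shifting by \<open>s\<close>
    undoes this modulo \<open>n\<close>.\<close>
  define d where "d = n - 1 - p (N - 1)"
  define s where "s = Suc (p (N - 1))"
  define q where "q j = p j + d" for j
  define b where "b i = nat (a ! ((i + s) mod n))" for i
  have ds: "d + s = n"
    using p_lt[of "N - 1"] N by (simp add: d_def s_def)
  have a_p: "a ! p j = int (k j) + 2" if "j < N" for j
    using nth_concat_offset[of "ipos j" \<sigma> 0] k[OF that] ipos_lt[OF that] len that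
    by (simp add: a_def p_def nth_singular_seq)
  have a_two: "a ! x = 2" if x: "x < n" "x \<notin> p ` {..<N}" for x
  proof -
    obtain i t where it: "i < L" "t < length (\<sigma> ! i)" "x = offset \<sigma> i + t"
      using offset_split[of x \<sigma>] x(1) len by (auto simp: n_def a_def)
    hence ax: "a ! x = \<sigma> ! i ! t"
      using nth_concat_offset[of i \<sigma> t] len by (simp add: a_def)
    show ?thesis
    proof (cases "is_singular (\<sigma> ! i)")
      case True
      then obtain j where j: "j < N" "i = ipos j"
        using sing it(1) by (metis (mono_tags, lifting) imageE lessThan_iff mem_Collect_eq)
      have "t \<noteq> 0"
        using x(2) it(3) j by (auto simp: p_def)
      thus ?thesis
        using ax it(2) j k[OF j(1)] by (simp add: nth_singular_seq)
    next
      case False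
      hence "is_regular (\<sigma> ! i)" using cases_\<sigma>[OF it(1)] by simp
      thus ?thesis
        using ax it(2) by (auto simp: is_regular_def regular_seq_def)
    qed
  qed
  have q_rot: "(q j + s) mod n = p j" if "j < N" for j
    using p_lt[OF that] ds by (simp add: q_def add.assoc)
  interpret singular_positions n N b q k A
  proof
    show "A \<subseteq> {..<N}" by (auto simp: A)
    show "if j \<in> A then q j + k j < q (Suc j) else q (Suc j) = q j + k j" if "j < N" for j
      using p_gap[OF that] by (simp add: q_def)
    show "q (N - 1) = n - 1"
      using p_lt[of "N - 1"] N by (simp add: q_def d_def)
    show "q N = q 0 + n"
      using N by (simp add: q_def p_def)
    show "b (q j) = k j + 2" if "j < N" for j
      using a_p[OF that] q_rot[OF that] by (simp add: b_def)
    show "b i = 2" if i: "i < n" "i \<notin> q ` {..<N}" for i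
    proof -
      have "(i + s) mod n \<notin> p ` {..<N}"
      proof
        assume "(i + s) mod n \<in> p ` {..<N}"
        then obtain j where j: "j < N" "(i + s) mod n = (q j + s) mod n"
          using q_rot by auto
        have "p j \<le> p (N - 1)"
        proof (cases "j = N - 1")
          case False
          hence "ipos j < ipos (N - 1)" using ipos_less[of j "N - 1"] j by simp
          thus ?thesis
            using offset_mono[of "ipos j" "ipos (N - 1)" \<sigma>] j by (simp add: p_def)
        qed simp
        hence "q j < n"
          using p_lt[of "N - 1"] N by (simp add: q_def d_def)
        hence "i = q j"
          using j(2) i(1) cong_add_rcancel_nat[of i s "q j" n] by (simp add: cong_def)
        thus False using i(2) j(1) by auto
      qed
      thus ?thesis
        using a_two[of "(i + s) mod n"] n2 by (simp add: b_def)
    qed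
  qed (use n2 N k in auto)
  have "a ! ((i + s) mod n) = int (b i)" if "i < n" for i
    using b_ge_two[OF that] by (simp add: b_def)
  thus ?thesis
    using det_rotated_seq_matrix[of a s] by (simp add: n_def a_def)
qed

end
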